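(* Suppose that $G$ is a non-Hausdorff étale groupoid with Hausdorff cover $\tilde{G}$. (I) A function $\tilde{f}\in C_c(\tilde{G})$ lies in the image of $\mathfrak{i}\colon\mathcal{C}_c(G)\to C_c(\tilde{G})$ if and only if $\tilde{f}$ is decomposable in the sense that $\tilde{f}(\mathbf{g})=\sum_{g\in\mathbf{g}}\tilde{f}(\iota(g))$ for all $\mathbf{g}\in\tilde{G}$. (II) Now further assume that $G$ is ample. Let $R$ be a ring. A function $\tilde{f}\in R\tilde{G}$ lies in the image of $\mathfrak{i}_R\colon RG\to R\tilde{G}$ if and only if $\tilde{f}$ is decomposable in the sense that $\tilde{f}(\mathbf{g})=\sum_{g\in\mathbf{g}}\tilde{f}(\iota(g))$ for all $\mathbf{g}\in\tilde{G}$.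
   Context: Groupoids. A groupoid $G$ is a small category all of whose morphisms are invertible, identified with its set of morphisms; $G^{(0)}\subseteq G$ is its set of units and $r,s\colon G\to G^{(0)}$ are range and source. Topological groupoids (continuous range, source, multiplication, inversion) are always assumed locally compact with $G^{(0)}$ Hausdorff in the subspace topology; $G$ itself need not be Hausdorff, and compact subsets need not be closed. $G$ is étale if $r$ is a local homeomorphism, and ample if in addition $G^{(0)}$ is totally disconnected. An open bisection is an open subset $U\subseteq G$ on which $r$ and $s$ are injective ($U$ is then locally compact Hausdorff). Function algebras. For an open bisection $U$, $C_c(U)$ is the set of continuous functions $U\to\mathbb{C}$ with compact support in $U$, extended by zero to functions on $G$; $\mathcal{C}_c(G)$ is the linear span of all $C_c(U)$. Rings need not be commutative or unital. For $G$ ample and a ring $R$, the Steinberg algebra $RG$ is the span of the functions $c_U\colon G\to R$ ($c\in R$, $U\subseteq G$ compact open bisection), where $c_U$ equals $c$ on $U$ and $0$ elsewhere. Products are given by convolution. Hausdorff cover. Equip the set of closed subsets of $G$ with the Fell topology, with basis the sets $\{F: F\cap U_i\neq\emptyset\ (1\le i\le n),\ F\cap K=\emptyset\}$ for $U_1,\dots,U_n\subseteq G$ open and $K\subseteq G$ compact. $\tilde{G}$ is the closure of $\{\{g\}:g\in G\}$ in the space of non-empty closed subsets, and $\iota\colon G\to\tilde{G}$, $\iota(g)=\{g\}$ (not continuous in general). $\tilde{G}$ is a locally compact Hausdorff étale groupoid with unit space the closure of $\iota(G^{(0)})$, source $\tilde{s}(\mathbf{g})=\{g_1^{-1}g_2:g_1,g_2\in\mathbf{g}\}$,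 range $\tilde{r}(\mathbf{g})=\{g_1g_2^{-1}:g_1,g_2\in\mathbf{g}\}$, and product (when $\tilde{s}(\mathbf{g})=\tilde{r}(\mathbf{h})$) and inverse those of subsets of $G$. It is ample if $G$ is. The maps $\mathfrak{i}$, $\mathfrak{i}_R$. $\mathfrak{i}\colon\mathcal{C}_c(G)\to C_c(\tilde{G})$ is the injective $*$-homomorphism $\mathfrak{i}(f)(\mathbf{g})=\sum_{g\in\mathbf{g}}f(g)$. For $G$ ample, $\mathfrak{i}_R\colon RG\to R\tilde{G}$ is the injective homomorphism determined by $c_U\mapsto c_{\tilde{U}}$, where $\tilde{U}=\{\mathbf{g}\in\tilde{G}:\mathbf{g}\cap U\neq\emptyset\}$. In the definition of decomposable it is understood that for each $\mathbf{g}$ only finitely many summands $\tilde{f}(\iota(g))$, $g\in\mathbf{g}$, are non-zero. *)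

theory Defs
  imports "HOL-Analysis.Analysis"
begin

section \<open>Topological groupoids\<close>

text \<open>
  The set of morphisms of a groupoid is the underlying set of its topology. The operations are
  total functions on the ambient type and are only constrained on morphisms; the product
  \<open>mult G x y\<close> is meaningful when \<open>src G x = rng G y\<close>.
\<close>

record 'g tgroupoid =
  gtop :: "'g topology"
  rng  :: "'g \<Rightarrow> 'g"
  src  :: "'g \<Rightarrow> 'g"
  mult :: "'g \<Rightarrow> 'g \<Rightarrow> 'g"
  ginv :: "'g \<Rightarrow> 'g"

definition arr :: "'g tgroupoid \<Rightarrow> 'g set" where
  "arr G = topspace (gtop G)"

definition units :: "'g tgroupoid \<Rightarrow> 'g set" where
  "units G = rng G ` arr G"

definition unit_top :: "'g tgroupoid \<Rightarrow> 'g topology" where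
  "unit_top G = subtopology (gtop G) (units G)"

locale groupoid =
  fixes G :: "'g tgroupoid"
  assumes rng_closed: "x \<in> arr G \<Longrightarrow> rng G x \<in> arr G"
    and src_closed: "x \<in> arr G \<Longrightarrow> src G x \<in> arr G"
    and rng_rng: "x \<in> arr G \<Longrightarrow> rng G (rng G x) = rng G x"
    and src_rng: "x \<in> arr G \<Longrightarrow> src G (rng G x) = rng G x"
    and rng_src: "x \<in> arr G \<Longrightarrow> rng G (src G x) = src G x"
    and src_src: "x \<in> arr G \<Longrightarrow> src G (src G x) = src G x"
    and mult_closed: "\<lbrakk>x \<in> arr G; y \<in> arr G; src G x = rng G y\<rbrakk> \<Longrightarrow> mult G x y \<in> arr G"
    and rng_mult: "\<lbrakk>x \<in> arr G; y \<in> arr G; src G x = rng G y\<rbrakk> \<Longrightarrow> rng G (mult G x y) = rng G x"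
    and src_mult: "\<lbrakk>x \<in> arr G; y \<in> arr G; src G x = rng G y\<rbrakk> \<Longrightarrow> src G (mult G x y) = src G y"
    and mult_assoc: "\<lbrakk>x \<in> arr G; y \<in> arr G; z \<in> arr G; src G x = rng G y; src G y = rng G z\<rbrakk>
          \<Longrightarrow> mult G (mult G x y) z = mult G x (mult G y z)"
    and rng_mult_left: "x \<in> arr G \<Longrightarrow> mult G (rng G x) x = x"
    and src_mult_right: "x \<in> arr G \<Longrightarrow> mult G x (src G x) = x"
    and inv_closed: "x \<in> arr G \<Longrightarrow> ginv G x \<in> arr G"
    and rng_inv: "x \<in> arr G \<Longrightarrow> rng G (ginv G x) = src G x"
    and src_inv: "x \<in> arr G \<Longrightarrow> src G (ginv G x) = rng G x"
    and inv_right: "x \<in> arr G \<Longrightarrow> mult G x (ginv G x) = rng G x"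
    and inv_left: "x \<in> arr G \<Longrightarrow> mult G (ginv G x) x = src G x"

text \<open>Only the unit space is required to be Hausdorff; the groupoid itself need not be.\<close>

locale topological_groupoid = groupoid +
  assumes continuous_rng: "continuous_map (gtop G) (unit_top G) (rng G)"
    and continuous_src: "continuous_map (gtop G) (unit_top G) (src G)"
    and continuous_mult:
      "continuous_map
         (subtopology (prod_topology (gtop G) (gtop G)) {(x, y). src G x = rng G y})
         (gtop G) (\<lambda>(x, y). mult G x y)"
    and continuous_inv: "continuous_map (gtop G) (gtop G) (ginv G)"
    and locally_compact: "locally_compact_space (gtop G)"
    and Hausdorff_units: "Hausdorff_space (unit_top G)"

definition local_homeomorphism :: "'a topology \<Rightarrow> 'b topology \<Rightarrow> ('a \<Rightarrow> 'b) \<Rightarrow> bool" where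
  "local_homeomorphism X Y f \<longleftrightarrow>
     (\<forall>x \<in> topspace X. \<exists>U. openin X U \<and> x \<in> U \<and> openin Y (f ` U) \<and>
        homeomorphic_map (subtopology X U) (subtopology Y (f ` U)) f)"

locale etale_groupoid = topological_groupoid +
  assumes local_homeomorphism_rng: "local_homeomorphism (gtop G) (unit_top G) (rng G)"

definition totally_disconnected :: "'a topology \<Rightarrow> bool" where
  "totally_disconnected X \<longleftrightarrow> (\<forall>S. connectedin X S \<longrightarrow> (\<exists>a. S \<subseteq> {a}))"

locale ample_groupoid = etale_groupoid +
  assumes totally_disconnected_units: "totally_disconnected (unit_top G)"

definition open_bisection :: "'g tgroupoid \<Rightarrow> 'g set \<Rightarrow> bool" where
  "open_bisection G U \<longleftrightarrow> openin (gtop G) U \<and> inj_on (rng G) U \<and> inj_on (src G) U"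


section \<open>Function algebras\<close>

text \<open>
  Functions on a groupoid, or on a subset of it, are extended by zero to the ambient type. The
  support of a function is its closed support in \<open>X\<close>.
\<close>

definition Cc :: "'a topology \<Rightarrow> ('a \<Rightarrow> complex) set" where
  "Cc X = {f. continuous_map X euclidean f \<and>
              compactin X (X closure_of {x \<in> topspace X. f x \<noteq> 0}) \<and>
              (\<forall>x. x \<notin> topspace X \<longrightarrow> f x = 0)}"

definition span_Cc :: "'g tgroupoid \<Rightarrow> ('g \<Rightarrow> complex) set" where
  "span_Cc G =
     {f. \<exists>(n::nat) a h. (\<forall>i<n. \<exists>U. open_bisection G U \<and> h i \<in> Cc (subtopology (gtop G) U)) \<and>
                        f = (\<lambda>x. \<Sum>i<n. a i * h i x)}"

definition const_on :: "'r::zero \<Rightarrow> 'a set \<Rightarrow> 'a \<Rightarrow> 'r" where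
  "const_on c U = (\<lambda>x. if x \<in> U then c else 0)"

definition compact_open_bisection :: "'g tgroupoid \<Rightarrow> 'g set \<Rightarrow> bool" where
  "compact_open_bisection G U \<longleftrightarrow> open_bisection G U \<and> compactin (gtop G) U"

text \<open>
  The class \<open>ring\<close> requires neither a unit nor commutativity. Since \<open>c\<close> ranges over all of the ring,
  the functions \<open>const_on c U\<close> are closed under multiplication by scalars, so their span consists of
  their finite sums.
\<close>

definition steinberg :: "'g tgroupoid \<Rightarrow> ('g \<Rightarrow> 'r::ring) set" where
  "steinberg G =
     {f. \<exists>(n::nat) c U. (\<forall>i<n. compact_open_bisection G (U i)) \<and>
                        f = (\<lambda>x. \<Sum>i<n. const_on (c i) (U i) x)}"


section \<open>The Hausdorff cover\<close>

definition fell_topology :: "'a topology \<Rightarrow> 'a set topology" where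
  "fell_topology X = topology_generated_by
     {{F. closedin X F \<and> (\<forall>U\<in>\<U>. F \<inter> U \<noteq> {}) \<and> F \<inter> K = {}} | \<U> K.
        finite \<U> \<and> (\<forall>U\<in>\<U>. openin X U) \<and> compactin X K}"

definition hcover_top :: "'g tgroupoid \<Rightarrow> 'g set topology" where
  "hcover_top G =
     (let Y = subtopology (fell_topology (gtop G)) {F. F \<noteq> {}}
      in subtopology Y (Y closure_of {{g} | g. g \<in> arr G}))"

definition set_mult :: "'g tgroupoid \<Rightarrow> 'g set \<Rightarrow> 'g set \<Rightarrow> 'g set" where
  "set_mult G A B = {mult G a b | a b. a \<in> A \<and> b \<in> B \<and> src G a = rng G b}"

definition hausdorff_cover :: "'g tgroupoid \<Rightarrow> 'g set tgroupoid" where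
  "hausdorff_cover G =
     \<lparr> gtop = hcover_top G,
       rng  = (\<lambda>A. set_mult G A (ginv G ` A)),
       src  = (\<lambda>A. set_mult G (ginv G ` A) A),
       mult = set_mult G,
       ginv = (\<lambda>A. ginv G ` A) \<rparr>"

text \<open>
  \<open>supp_sum f A\<close> is the sum of \<open>f\<close> over the points of \<open>A\<close> where it does not vanish. For
  \<open>f \<in> span_Cc G\<close> and \<open>A\<close> in the Hausdorff cover there are only finitely many of them, because
  \<open>rng G\<close> is constant on \<open>A\<close> and so \<open>A\<close> meets an open bisection in at most one point.
\<close>

definition hc_map :: "'g tgroupoid \<Rightarrow> ('g \<Rightarrow> complex) \<Rightarrow> 'g set \<Rightarrow> complex" where
  "hc_map G f = (\<lambda>A. if A \<in> arr (hausdorff_cover G) then supp_sum f A else 0)"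

definition hc_lift :: "'g tgroupoid \<Rightarrow> 'g set \<Rightarrow> 'g set set" where
  "hc_lift G U = {A \<in> arr (hausdorff_cover G). A \<inter> U \<noteq> {}}"

text \<open>
  The homomorphism determined by \<open>const_on c U \<mapsto> const_on c (hc_lift G U)\<close>. As the functions
  \<open>const_on c U\<close> span \<open>steinberg G\<close> additively, additivity alone determines it on \<open>steinberg G\<close>;
  outside \<open>steinberg G\<close> it is fixed to be \<open>undefined\<close>, so that the description is unique.
\<close>

definition hc_map_ring :: "'g tgroupoid \<Rightarrow> ('g \<Rightarrow> 'r::ring) \<Rightarrow> 'g set \<Rightarrow> 'r" where
  "hc_map_ring G =
     (THE \<phi>. \<phi> \<in> extensional (steinberg G) \<and>
             (\<forall>f \<in> steinberg G. \<forall>h \<in> steinberg G.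
                \<phi> (\<lambda>x. f x + h x) = (\<lambda>A. \<phi> f A + \<phi> h A)) \<and>
             (\<forall>c U. compact_open_bisection G U \<longrightarrow>
                \<phi> (const_on c U) = const_on c (hc_lift G U)))"

definition decomposable :: "'g tgroupoid \<Rightarrow> ('g set \<Rightarrow> 'r::comm_monoid_add) \<Rightarrow> bool" where
  "decomposable G F \<longleftrightarrow>
     (\<forall>A \<in> arr (hausdorff_cover G).
        finite {g \<in> A. F {g} \<noteq> 0} \<and> F A = supp_sum (\<lambda>g. F {g}) A)"

end

theory Submission
  imports Defs
begin

text \<open>
  Put \<open>f g = F {g}\<close>; decomposability says that \<open>F\<close> is the fibrewise sum of \<open>f\<close>, so the point is to
  show that \<open>f\<close> lies in the algebra of \<open>G\<close>. Compactness of the support of \<open>F\<close> gives finitely many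
  open bisections \<open>U\<^sub>1, \<dots>, U\<^sub>n\<close> outside of which \<open>f\<close> vanishes, and we induct on \<open>n\<close>. Let \<open>V\<close> be the
  union of \<open>U\<^sub>1, \<dots>, U\<^sub>m\<close> with \<open>m = n - 1\<close>. If points of \<open>U\<^sub>n - V\<close> converge to \<open>g \<in> U\<^sub>n - V\<close> in \<open>G\<close>, then they
  accumulate in the cover at some \<open>A\<close> containing \<open>g\<close> and disjoint from \<open>V\<close>; as \<open>A\<close> has no other point
  in \<open>U\<^sub>n\<close>, decomposability gives \<open>F A = f g\<close>. Hence \<open>f\<close> is continuous on the relatively closed subset
  \<open>U\<^sub>n - V\<close> and extends to a function \<open>h\<close> of the algebra supported on a bisection, by Tietze's theorem in the
  complex case and by partitioning into compact open sets in the ample case. Now \<open>f - h\<close> vanishes outside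
  \<open>V\<close>. Both cases are treated together by giving the coefficients the Euclidean or the discrete
  topology.
\<close>

section \<open>The Fell topology\<close>

lemma topspace_fell_topology [simp]: "topspace (fell_topology X) = {F. closedin X F}"
proof -
  have "{F. closedin X F} = {F. closedin X F \<and> (\<forall>U\<in>{}. F \<inter> U \<noteq> {}) \<and> F \<inter> {} = {}}"
    by simp
  then have "{F. closedin X F} \<in> {{F. closedin X F \<and> (\<forall>U\<in>\<U>. F \<inter> U \<noteq> {}) \<and> F \<inter> K = {}} | \<U> K.
        finite \<U> \<and> (\<forall>U\<in>\<U>. openin X U) \<and> compactin X K}"
    by blast
  then show ?thesis
    unfolding fell_topology_def topology_generated_by_topspace by blast
qed

lemma openin_fell_hit:
  assumes "openin X U"
  shows "openin (fell_topology X) {F. closedin X F \<and> F \<inter> U \<noteq> {}}"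
  unfolding fell_topology_def
proof (rule topology_generated_by_Basis, safe)
  show "\<exists>\<U> K. {F. closedin X F \<and> F \<inter> U \<noteq> {}} =
      {F. closedin X F \<and> (\<forall>U\<in>\<U>. F \<inter> U \<noteq> {}) \<and> F \<inter> K = {}} \<and>
      finite \<U> \<and> (\<forall>U\<in>\<U>. openin X U) \<and> compactin X K"
    using assms by (intro exI[of _ "{U}"] exI[of _ "{}"]) auto
qed

lemma openin_fell_miss:
  assumes "compactin X K"
  shows "openin (fell_topology X) {F. closedin X F \<and> F \<inter> K = {}}"
  unfolding fell_topology_def
proof (rule topology_generated_by_Basis, safe)
  show "\<exists>\<U> K'. {F. closedin X F \<and> F \<inter> K = {}} =
      {F. closedin X F \<and> (\<forall>U\<in>\<U>. F \<inter> U \<noteq> {}) \<and> F \<inter> K' = {}} \<and>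
      finite \<U> \<and> (\<forall>U\<in>\<U>. openin X U) \<and> compactin X K'"
    using assms by (intro exI[of _ "{}"] exI[of _ K]) auto
qed

text \<open>A basic Fell set is a finite intersection of hit sets and one miss set, so it suffices
  to test these two kinds. This compares the Fell topology with the subbase topology to which
  Alexander's lemma applies.\<close>

lemma openin_fell_coarsest:
  assumes hit: "\<And>U. openin X U \<Longrightarrow> openin Y {F. closedin X F \<and> F \<inter> U \<noteq> {}}"
    and miss: "\<And>K. compactin X K \<Longrightarrow> openin Y {F. closedin X F \<and> F \<inter> K = {}}"
    and "openin (fell_topology X) W"
  shows "openin Y W"
proof (rule generate_topology_on_coarsest)
  show "istopology (openin Y)" by simp
  show "generate_topology_on {{F. closedin X F \<and> (\<forall>U\<in>\<U>. F \<inter> U \<noteq> {}) \<and> F \<inter> K = {}} | \<U> K.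
        finite \<U> \<and> (\<forall>U\<in>\<U>. openin X U) \<and> compactin X K} W"
    using assms(3) unfolding fell_topology_def openin_topology_generated_by_iff .
next
  fix S assume "S \<in> {{F. closedin X F \<and> (\<forall>U\<in>\<U>. F \<inter> U \<noteq> {}) \<and> F \<inter> K = {}} | \<U> K.
        finite \<U> \<and> (\<forall>U\<in>\<U>. openin X U) \<and> compactin X K}"
  then obtain \<U> K where S: "S = {F. closedin X F \<and> (\<forall>U\<in>\<U>. F \<inter> U \<noteq> {}) \<and> F \<inter> K = {}}"
    and fin: "finite \<U>" "\<forall>U\<in>\<U>. openin X U" "compactin X K" by blast
  have "openin Y (\<Inter> (insert {F. closedin X F \<and> F \<inter> K = {}}
                   ((\<lambda>U. {F. closedin X F \<and> F \<inter> U \<noteq> {}}) ` \<U>)))"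
    using fin hit miss by (intro openin_Inter) auto
  also have "\<Inter> (insert {F. closedin X F \<and> F \<inter> K = {}}
                   ((\<lambda>U. {F. closedin X F \<and> F \<inter> U \<noteq> {}}) ` \<U>)) = S"
    using S by auto
  finally show "openin Y S" .
qed

text \<open>
  In a cover by subbasic sets, the closed set avoiding all the open sets that are to be hit lies
  in some miss set; its compact set is covered by finitely many of those open sets.
\<close>

lemma compact_space_fell_topology: "compact_space (fell_topology X)"
proof -
  let ?hit = "\<lambda>U. {F. closedin X F \<and> F \<inter> U \<noteq> {}}"
  let ?miss = "\<lambda>K. {F. closedin X F \<and> F \<inter> K = {}}"
  let ?\<B> = "?hit ` Collect (openin X) \<union> ?miss ` Collect (compactin X)"
  let ?Y = "topology (arbitrary union_of (finite intersection_of (\<lambda>x. x \<in> ?\<B>)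
                 relative_to (Collect (closedin X))))"
  have miss_empty: "?miss {} = Collect (closedin X)" by auto
  have "compact_space ?Y"
  proof (rule Alexander_subbase_alt[OF _ _ refl])
    show "Collect (closedin X) \<subseteq> \<Union>?\<B>" using miss_empty by blast
  next
    fix C assume C: "C \<subseteq> ?\<B>" and cov: "Collect (closedin X) \<subseteq> \<Union>C"
    define \<U> where "\<U> = {U. openin X U \<and> ?hit U \<in> C}"
    define Z where "Z = topspace X - \<Union>\<U>"
    have "openin X (\<Union>\<U>)" by (auto simp: \<U>_def)
    then have "closedin X Z" by (auto simp: Z_def)
    then obtain c where c: "c \<in> C" "Z \<in> c" using cov by blast
    have "c \<notin> ?hit ` Collect (openin X)"
      using c by (auto simp: Z_def \<U>_def)
    then have "c \<in> ?miss ` Collect (compactin X)" using C c(1) by (meson UnE subsetD)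
    then obtain K where K: "compactin X K" "c = ?miss K" by auto
    then have "K \<subseteq> \<Union>\<U>"
      using c compactin_subset_topspace[of X K] by (auto simp: Z_def)
    then obtain \<F> where \<F>: "finite \<F>" "\<F> \<subseteq> \<U>" "K \<subseteq> \<Union>\<F>"
      using compactinD[OF K(1), of \<U>] unfolding \<U>_def by blast
    show "\<exists>C'. finite C' \<and> C' \<subseteq> C \<and> Collect (closedin X) \<subseteq> \<Union>C'"
    proof (intro exI conjI)
      show "finite (insert c (?hit ` \<F>))" using \<F> by simp
      show "insert c (?hit ` \<F>) \<subseteq> C" using \<F> c by (auto simp: \<U>_def)
      show "Collect (closedin X) \<subseteq> \<Union>(insert c (?hit ` \<F>))"
      proof
        fix F assume F: "F \<in> Collect (closedin X)"
        show "F \<in> \<Union>(insert c (?hit ` \<F>))"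
        proof (cases "F \<inter> K = {}")
          case True
          then show ?thesis using F K(2) by simp
        next
          case False
          then obtain U where "U \<in> \<F>" "F \<inter> U \<noteq> {}" using \<F>(3) by blast
          then show ?thesis using F by blast
        qed
      qed
    qed
  qed
  then have "compactin ?Y (Collect (closedin X))"
    unfolding compact_space_def topspace_subbase .
  \<comment> \<open>Compactness passes to a coarser topology on the same points, and every Fell-open
    set is open in \<open>?Y\<close>.\<close>
  then have "compactin (fell_topology X) (Collect (closedin X))"
  proof (rule compactin_contractive)
    show "topspace ?Y = topspace (fell_topology X)"
      unfolding topspace_subbase by simp
    have *: "openin ?Y B" if "B \<in> ?\<B>" for B
    proof -
      have "B \<subseteq> Collect (closedin X)" using that by blast
      then have "B = Collect (closedin X) \<inter> B" by blast
      then show ?thesis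
        unfolding openin_subbase
        by (metis (no_types, lifting) arbitrary_union_of_inc finite_intersection_of_inc relative_to_inc that)
    qed
    show "openin ?Y W" if "openin (fell_topology X) W" for W
      by (rule openin_fell_coarsest[OF _ _ that]; rule *) blast+
  qed
  then show ?thesis by (simp add: compact_space_def)
qed

section \<open>The Hausdorff cover of an etale groupoid\<close>

lemma topspace_hcover_top [simp]: "topspace (hcover_top G) = arr (hausdorff_cover G)"
  by (simp add: arr_def hausdorff_cover_def)

lemma gtop_hausdorff_cover [simp]: "gtop (hausdorff_cover G) = hcover_top G"
  by (simp add: hausdorff_cover_def)

text \<open>Taking the closure among the nonempty closed sets only removes the empty set, which may
  itself be a Fell limit of singletons. Hence the cover is a single subspace of the compact Fell
  space.\<close>

lemma hcover_top_eq:
  "hcover_top G = subtopology (fell_topology (gtop G))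
     ({F. F \<noteq> {}} \<inter> fell_topology (gtop G) closure_of {{g} | g. g \<in> arr G})"
proof -
  have "{F. F \<noteq> {}} \<inter> {{g} | g. g \<in> arr G} = {{g} | g. g \<in> arr G}" by auto
  then show ?thesis
    unfolding hcover_top_def Let_def closure_of_subtopology subtopology_subtopology
    by (simp add: Int_commute Int_left_absorb)
qed

lemma arr_hausdorff_cover:
  "arr (hausdorff_cover G) =
     {F. F \<noteq> {}} \<inter> fell_topology (gtop G) closure_of {{g} | g. g \<in> arr G}"
proof -
  have "arr (hausdorff_cover G) = topspace (hcover_top G)" by simp
  also have "\<dots> = topspace (fell_topology (gtop G)) \<inter>
     ({F. F \<noteq> {}} \<inter> fell_topology (gtop G) closure_of {{g} | g. g \<in> arr G})"
    by (subst hcover_top_eq) (rule topspace_subtopology)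
  also have "\<dots> = {F. F \<noteq> {}} \<inter> fell_topology (gtop G) closure_of {{g} | g. g \<in> arr G}"
    using closure_of_subset_topspace by fastforce
  finally show ?thesis .
qed

lemma closedin_hausdorff_cover:
  assumes "A \<in> arr (hausdorff_cover G)"
  shows "closedin (gtop G) A"
proof -
  have "A \<in> fell_topology (gtop G) closure_of {{g} | g. g \<in> arr G}"
    using assms unfolding arr_hausdorff_cover by blast
  then have "A \<in> topspace (fell_topology (gtop G))"
    using closure_of_subset_topspace by (rule subsetD[rotated])
  then show ?thesis by simp
qed

lemma hausdorff_cover_nonempty: "A \<in> arr (hausdorff_cover G) \<Longrightarrow> A \<noteq> {}"
  unfolding arr_hausdorff_cover by blast

lemma hausdorff_cover_subset: "A \<in> arr (hausdorff_cover G) \<Longrightarrow> A \<subseteq> arr G"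
  unfolding arr_def[of G] by (rule closedin_subset[OF closedin_hausdorff_cover])

lemma openin_hc_lift:
  assumes "openin (gtop G) U"
  shows "openin (hcover_top G) (hc_lift G U)"
proof -
  have "hc_lift G U = {F. closedin (gtop G) F \<and> F \<inter> U \<noteq> {}} \<inter> arr (hausdorff_cover G)"
    using closedin_hausdorff_cover[of _ G] unfolding hc_lift_def by blast
  then show ?thesis
    unfolding hcover_top_eq openin_subtopology arr_hausdorff_cover
    using openin_fell_hit[OF assms] by blast
qed

lemma closedin_hc_lift:
  assumes "compactin (gtop G) K"
  shows "closedin (hcover_top G) (hc_lift G K)"
proof -
  have "arr (hausdorff_cover G) - hc_lift G K =
      {F. closedin (gtop G) F \<and> F \<inter> K = {}} \<inter> arr (hausdorff_cover G)"
    using closedin_hausdorff_cover[of _ G] unfolding hc_lift_def by blast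
  then have "openin (hcover_top G) (arr (hausdorff_cover G) - hc_lift G K)"
    unfolding hcover_top_eq openin_subtopology arr_hausdorff_cover
    using openin_fell_miss[OF assms] by blast
  then show ?thesis
    unfolding closedin_def topspace_hcover_top by (simp add: hc_lift_def)
qed

text \<open>Meeting \<open>K\<close> already excludes the empty set, so the lift is closed in the
  whole Fell space and not only in the cover. Compactness of the Fell space then applies.\<close>

lemma compactin_hc_lift:
  assumes "compactin (gtop G) K"
  shows "compactin (hcover_top G) (hc_lift G K)"
proof -
  let ?X = "fell_topology (gtop G)"
  let ?S = "?X closure_of {{g} | g. g \<in> arr G}"
  have eq: "hc_lift G K = ?S - {F. closedin (gtop G) F \<and> F \<inter> K = {}}"
    using closure_of_subset_topspace[of ?X "{{g} | g. g \<in> arr G}"]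
    unfolding hc_lift_def arr_hausdorff_cover topspace_fell_topology by blast
  have "closedin ?X (hc_lift G K)"
    unfolding eq using openin_fell_miss[OF assms] by (intro closedin_diff) auto
  then have "compactin ?X (hc_lift G K)"
    by (rule closedin_compact_space[OF compact_space_fell_topology])
  then show ?thesis
    unfolding hcover_top_eq compactin_subtopology
    by (auto simp: hc_lift_def arr_hausdorff_cover)
qed

text \<open>\<open>A\<close> is a limit of singletons, and a singleton near \<open>A\<close> hits
  both \<open>U\<close> and \<open>V\<close>; its only point then lies in both.\<close>

lemma hausdorff_cover_not_separated:
  assumes A: "A \<in> arr (hausdorff_cover G)" "a \<in> A" "b \<in> A"
    and UV: "openin (gtop G) U" "openin (gtop G) V" "a \<in> U" "b \<in> V"
  shows "U \<inter> V \<noteq> {}"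
proof -
  let ?W = "{F. closedin (gtop G) F \<and> F \<inter> U \<noteq> {}} \<inter> {F. closedin (gtop G) F \<and> F \<inter> V \<noteq> {}}"
  have "openin (fell_topology (gtop G)) ?W"
    by (intro openin_Int openin_fell_hit UV)
  moreover have "A \<in> ?W"
    using assms closedin_hausdorff_cover[of A G] by blast
  moreover have "A \<in> fell_topology (gtop G) closure_of {{g} | g. g \<in> arr G}"
    using A by (simp add: arr_hausdorff_cover)
  ultimately obtain y where "y \<in> {{g} | g. g \<in> arr G}" "y \<in> ?W"
    unfolding in_closure_of by meson
  then show ?thesis by auto
qed

section \<open>Open bisections and compact neighbourhoods\<close>

context etale_groupoid
begin

text \<open>The range map is a continuous injection of \<open>U\<close> into the Hausdorff unit
  space.\<close>

lemma Hausdorff_space_open_bisection: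
  assumes "open_bisection G U"
  shows "Hausdorff_space (subtopology (gtop G) U)"
proof (rule Hausdorff_space_injective_preimage[OF Hausdorff_units])
  show "continuous_map (subtopology (gtop G) U) (unit_top G) (rng G)"
    by (rule continuous_map_from_subtopology[OF continuous_rng])
  show "inj_on (rng G) (topspace (subtopology (gtop G) U))"
    using assms by (auto simp: open_bisection_def intro: inj_on_subset)
qed

text \<open>Distinct points of \<open>U\<close> have disjoint neighbourhoods that are open in
  \<open>G\<close>, which \<open>hausdorff_cover_not_separated\<close> forbids for two points of
  \<open>A\<close>. Sums over \<open>A\<close> of functions supported on a bisection therefore have
  at most one nonzero term.\<close>

lemma at_most_one_in_bisection:
  assumes A: "A \<in> arr (hausdorff_cover G)" "a \<in> A" "b \<in> A"
    and U: "open_bisection G U" "a \<in> U" "b \<in> U"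
  shows "a = b"
proof (rule ccontr)
  assume "a \<noteq> b"
  moreover have "openin (gtop G) U" using U by (simp add: open_bisection_def)
  moreover have "a \<in> topspace (gtop G)" "b \<in> topspace (gtop G)"
    using calculation U openin_subset by blast+
  ultimately obtain V W where "openin (gtop G) V" "openin (gtop G) W" "a \<in> V" "b \<in> W" "disjnt V W"
    using Hausdorff_space_open_bisection[OF U(1)] U
    unfolding Hausdorff_space_def topspace_subtopology by (metis IntI openin_open_subtopology)
  then show False
    using hausdorff_cover_not_separated[OF A] by (meson disjnt_def)
qed

lemma open_subset_bisection:
  "open_bisection G U \<Longrightarrow> openin (gtop G) V \<Longrightarrow> V \<subseteq> U \<Longrightarrow> open_bisection G V"
  by (auto simp: open_bisection_def intro: inj_on_subset)

lemma openin_units_rng: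
  assumes "openin (gtop G) U"
  shows "openin (unit_top G) (rng G ` U)"
proof (subst openin_subopen, safe)
  fix x assume x: "x \<in> U"
  then have "x \<in> topspace (gtop G)" using assms openin_subset by blast
  then obtain V where V: "openin (gtop G) V" "x \<in> V" "openin (unit_top G) (rng G ` V)"
    "homeomorphic_map (subtopology (gtop G) V) (subtopology (unit_top G) (rng G ` V)) (rng G)"
    using local_homeomorphism_rng unfolding local_homeomorphism_def by meson
  have "openin (subtopology (gtop G) V) (U \<inter> V)"
    using assms V by (simp add: openin_open_subtopology openin_Int)
  then have "openin (subtopology (unit_top G) (rng G ` V)) (rng G ` (U \<inter> V))"
    using homeomorphic_map_openness_eq[OF V(4)] by blast
  then have "openin (unit_top G) (rng G ` (U \<inter> V))"
    using V(3) openin_open_subtopology by blast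
  then show "\<exists>T. openin (unit_top G) T \<and> rng G x \<in> T \<and> T \<subseteq> rng G ` U"
    using x V by (intro exI[of _ "rng G ` (U \<inter> V)"]) auto
qed

text \<open>A unit is fixed by \<open>rng\<close>, which is open and continuous, so the image of a
  compact neighbourhood in \<open>G\<close> is a compact neighbourhood in the unit space.\<close>

lemma locally_compact_units: "locally_compact_space (unit_top G)"
  unfolding locally_compact_space_def
proof
  fix x assume "x \<in> topspace (unit_top G)"
  then have "x \<in> arr G" and "rng G x = x"
    by (auto simp: unit_top_def units_def arr_def rng_rng[unfolded arr_def])
  then obtain U K where "openin (gtop G) U" "compactin (gtop G) K" "x \<in> U" "U \<subseteq> K"
    using locally_compact unfolding locally_compact_space_def arr_def by meson
  then show "\<exists>U K. openin (unit_top G) U \<and> compactin (unit_top G) K \<and> x \<in> U \<and> U \<subseteq> K"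
    using \<open>rng G x = x\<close> openin_units_rng image_compactin[OF _ continuous_rng]
    by (intro exI[of _ "rng G ` U"] exI[of _ "rng G ` K"]) (metis image_eqI image_mono)
qed

lemma ginv_ginv:
  assumes x: "x \<in> arr G"
  shows "ginv G (ginv G x) = x"
proof -
  let ?y = "ginv G x"
  have y: "?y \<in> arr G" "ginv G ?y \<in> arr G" using x inv_closed by auto
  have "ginv G ?y = mult G (rng G x) (ginv G ?y)"
    using rng_mult_left[OF y(2)] x y by (simp add: rng_inv src_inv)
  also have "\<dots> = mult G x (mult G ?y (ginv G ?y))"
    using mult_assoc[OF x y] x y by (simp add: rng_inv src_inv inv_right)
  also have "\<dots> = x"
    using x y by (simp add: rng_inv inv_right src_mult_right)
  finally show ?thesis .
qed

text \<open>The local homeomorphism at \<open>g\<close> gives injectivity of \<open>rng\<close>.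
  Injectivity of \<open>src\<close> comes from the local homeomorphism at the inverse of
  \<open>g\<close>, because the source of \<open>x\<close> is the range of its inverse. The
  homeomorphism in the conclusion is kept in order to carry local compactness from the units to
  \<open>U\<close>.\<close>

lemma obtain_open_bisection:
  assumes "openin (gtop G) W" "g \<in> W"
  obtains U where "open_bisection G U" "g \<in> U" "U \<subseteq> W"
    "homeomorphic_map (subtopology (gtop G) U) (subtopology (unit_top G) (rng G ` U)) (rng G)"
proof -
  have g: "g \<in> topspace (gtop G)" using assms openin_subset by blast
  then have gi: "ginv G g \<in> topspace (gtop G)" using inv_closed by (simp add: arr_def)
  obtain V where V: "openin (gtop G) V" "g \<in> V"
    "homeomorphic_map (subtopology (gtop G) V) (subtopology (unit_top G) (rng G ` V)) (rng G)"
    using local_homeomorphism_rng g unfolding local_homeomorphism_def by meson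
  obtain V' where V': "openin (gtop G) V'" "ginv G g \<in> V'"
    "homeomorphic_map (subtopology (gtop G) V') (subtopology (unit_top G) (rng G ` V')) (rng G)"
    using local_homeomorphism_rng gi unfolding local_homeomorphism_def by meson
  define U where "U = V \<inter> {x \<in> topspace (gtop G). ginv G x \<in> V'} \<inter> W"
  have "openin (gtop G) {x \<in> topspace (gtop G). ginv G x \<in> V'}"
    using openin_continuous_map_preimage[OF continuous_inv V'(1)] .
  then have oU: "openin (gtop G) U"
    unfolding U_def using assms V by blast
  have "U \<subseteq> V" by (auto simp: U_def)
  from oU have Ut: "U \<subseteq> arr G" using openin_subset by (auto simp: arr_def)
  have injV: "inj_on (rng G) V"
    using homeomorphic_imp_injective_map[OF V(3)] openin_subset[OF V(1)]
    by (simp add: inf.absorb2)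
  have injV': "inj_on (rng G) V'"
    using homeomorphic_imp_injective_map[OF V'(3)] openin_subset[OF V'(1)]
    by (simp add: inf.absorb2)
  have "inj_on (src G) U"
  proof (rule inj_onI)
    fix x y assume xy: "x \<in> U" "y \<in> U" "src G x = src G y"
    then have arr: "x \<in> arr G" "y \<in> arr G" using Ut by blast+
    have "rng G (ginv G x) = rng G (ginv G y)"
      using xy(3) rng_inv[OF arr(1)] rng_inv[OF arr(2)] by simp
    moreover have "ginv G x \<in> V'" "ginv G y \<in> V'" using xy by (simp_all add: U_def)
    ultimately have "ginv G x = ginv G y" by (rule inj_onD[OF injV'])
    then show "x = y" using arr ginv_ginv by metis
  qed
  moreover have "inj_on (rng G) U" using injV \<open>U \<subseteq> V\<close> by (rule inj_on_subset)
  ultimately have "open_bisection G U" using oU by (simp add: open_bisection_def)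
  moreover have "homeomorphic_map (subtopology (gtop G) U) (subtopology (unit_top G) (rng G ` U)) (rng G)"
  proof -
    have "homeomorphic_map (subtopology (subtopology (gtop G) V) U)
        (subtopology (subtopology (unit_top G) (rng G ` V)) (rng G ` U)) (rng G)"
    proof (rule homeomorphic_map_subtopologies_alt[OF V(3)])
      show "rng G x \<in> rng G ` U \<longleftrightarrow> x \<in> U" if "x \<in> topspace (subtopology (gtop G) V)" for x
        using that injV \<open>U \<subseteq> V\<close> by (simp add: inj_on_image_mem_iff)
    qed
    then show ?thesis
      by (simp add: subtopology_subtopology inf.absorb2 \<open>U \<subseteq> V\<close> image_mono)
  qed
  moreover have "g \<in> U" "U \<subseteq> W" using g V V' assms(2) by (simp_all add: U_def)
  ultimately show ?thesis using that[of U] by iprover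
qed

end

lemma supp_sum_eq_sum:
  assumes "finite B" "{a \<in> A. f a \<noteq> 0} \<subseteq> B" "B \<subseteq> A"
  shows "supp_sum f A = sum f B"
  unfolding supp_sum_def support_on_def
  using assms by (intro sum.mono_neutral_left) auto

context etale_groupoid
begin

text \<open>Local compactness of \<open>G\<close> provides some compact neighbourhood of each point,
  and in a non-Hausdorff space this does not yield small ones. They are taken inside a bisection,
  which is homeomorphic to an open subset of the locally compact Hausdorff unit space.\<close>

lemma obtain_compact_neighbourhood:
  assumes "openin (gtop G) W" "g \<in> W"
  obtains U V K where "open_bisection G U" "openin (gtop G) V" "compactin (gtop G) K"
    "g \<in> V" "V \<subseteq> K" "K \<subseteq> U" "U \<subseteq> W"
proof -
  obtain U where U: "open_bisection G U" "g \<in> U" "U \<subseteq> W"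
    "homeomorphic_map (subtopology (gtop G) U) (subtopology (unit_top G) (rng G ` U)) (rng G)"
    by (rule obtain_open_bisection[OF assms])
  have oU: "openin (gtop G) U" using U(1) by (simp add: open_bisection_def)
  have "locally_compact_space (subtopology (unit_top G) (rng G ` U))"
    using Hausdorff_units locally_compact_units openin_units_rng[OF oU]
    by (blast intro: locally_compact_space_open_subset)
  then have "locally_compact_space (subtopology (gtop G) U)"
    using homeomorphic_locally_compact_space[OF homeomorphic_map_imp_homeomorphic_space[OF U(4)]]
    by blast
  moreover have "g \<in> topspace (subtopology (gtop G) U)"
    using U(2) openin_subset[OF oU] by auto
  ultimately obtain V K where VK: "openin (subtopology (gtop G) U) V"
    "compactin (subtopology (gtop G) U) K" "g \<in> V" "V \<subseteq> K"
    unfolding locally_compact_space_def by meson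
  have "openin (gtop G) V" using VK(1) openin_open_subtopology[OF oU] by blast
  moreover have "compactin (gtop G) K" "K \<subseteq> U" using VK(2) unfolding compactin_subtopology by auto
  ultimately show ?thesis using that[OF U(1) _ _ VK(3,4) _ U(3)] by iprover
qed

text \<open>A point with the same range as \<open>g\<close> is kept apart from \<open>g\<close> by
  any open bisection around it; a point with another range is kept apart by Hausdorffness of the
  units.\<close>

lemma singleton_closedin:
  assumes "g \<in> arr G"
  shows "closedin (gtop G) {g}"
proof -
  have "openin (gtop G) (topspace (gtop G) - {g})"
  proof (subst openin_subopen, intro ballI)
    fix h assume h: "h \<in> topspace (gtop G) - {g}"
    show "\<exists>T. openin (gtop G) T \<and> h \<in> T \<and> T \<subseteq> topspace (gtop G) - {g}"
    proof (cases "rng G h = rng G g")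
      case True
      obtain U where U: "open_bisection G U" "h \<in> U" "U \<subseteq> topspace (gtop G)"
        using h by (rule_tac obtain_open_bisection[of "topspace (gtop G)" h]) auto
      then have "g \<notin> U"
        using h True by (auto simp: open_bisection_def inj_on_def)
      then show ?thesis using U unfolding open_bisection_def by blast
    next
      case False
      have "rng G h \<in> topspace (unit_top G)" "rng G g \<in> topspace (unit_top G)"
        using continuous_map_image_subset_topspace[OF continuous_rng] h assms
        by (auto simp: arr_def)
      then obtain O1 O2 where O: "openin (unit_top G) O1" "openin (unit_top G) O2"
        "rng G h \<in> O1" "rng G g \<in> O2" "disjnt O1 O2"
        using Hausdorff_units False unfolding Hausdorff_space_def by meson
      then have "openin (gtop G) {x \<in> topspace (gtop G). rng G x \<in> O1}"
        using openin_continuous_map_preimage[OF continuous_rng] by blast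
      moreover have "rng G g \<notin> O1" using O by (auto simp: disjnt_def)
      ultimately show ?thesis using h O(3)
        by (intro exI[of _ "{x \<in> topspace (gtop G). rng G x \<in> O1}"]) auto
    qed
  qed
  then show ?thesis using assms unfolding closedin_def arr_def by simp
qed

section \<open>Separation and compactness in the Hausdorff cover\<close>

lemma singleton_in_hausdorff_cover:
  assumes "g \<in> arr G"
  shows "{g} \<in> arr (hausdorff_cover G)"
proof -
  let ?S = "{{g} | g. g \<in> arr G}"
  have "?S \<subseteq> topspace (fell_topology (gtop G))"
    using singleton_closedin by auto
  then have "?S \<subseteq> fell_topology (gtop G) closure_of ?S"
    by (rule closure_of_subset)
  then show ?thesis
    using assms unfolding arr_hausdorff_cover by blast
qed

lemma obtain_neighbourhood_missing:
  assumes A: "A \<in> arr (hausdorff_cover G)" and g: "g \<in> arr G" "g \<notin> A"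
  obtains V K where "openin (gtop G) V" "compactin (gtop G) K" "g \<in> V" "V \<subseteq> K" "A \<inter> K = {}"
proof -
  have "openin (gtop G) (topspace (gtop G) - A)"
    using closedin_hausdorff_cover[OF A] by (simp add: closedin_def)
  moreover have "g \<in> topspace (gtop G) - A" using g by (simp add: arr_def)
  ultimately obtain U V K where K: "openin (gtop G) V" "compactin (gtop G) K"
    "g \<in> V" "V \<subseteq> K" "K \<subseteq> U" "U \<subseteq> topspace (gtop G) - A"
    by (rule obtain_compact_neighbourhood)
  moreover have "A \<inter> K = {}" using K(5,6) by auto
  ultimately show ?thesis using that by metis
qed

text \<open>If \<open>a\<close> lies in \<open>A\<close> but not in \<open>B\<close>, some compact
  neighbourhood \<open>K\<close> of \<open>a\<close> misses \<open>B\<close>. Hitting an open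
  \<open>V\<close> with \<open>a \<in> V \<subseteq> K\<close> and missing \<open>K\<close> are then
  disjoint open conditions, satisfied by \<open>A\<close> and \<open>B\<close>.\<close>

lemma Hausdorff_hcover: "Hausdorff_space (hcover_top G)"
proof -
  have sep: "\<exists>V W. openin (hcover_top G) V \<and> openin (hcover_top G) W \<and> A \<in> V \<and> B \<in> W \<and> disjnt V W"
    if A: "A \<in> arr (hausdorff_cover G)" and B: "B \<in> arr (hausdorff_cover G)" and a: "a \<in> A" "a \<notin> B"
    for A B a
  proof -
    have "a \<in> arr G" using hausdorff_cover_subset[OF A] a by blast
    then obtain V K where VK: "openin (gtop G) V" "compactin (gtop G) K" "a \<in> V" "V \<subseteq> K" "B \<inter> K = {}"
      using obtain_neighbourhood_missing[OF B] a by metis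
    show ?thesis
    proof (intro exI conjI)
      show "openin (hcover_top G) (hc_lift G V)" by (rule openin_hc_lift[OF VK(1)])
      show "openin (hcover_top G) (arr (hausdorff_cover G) - hc_lift G K)"
        using closedin_hc_lift[OF VK(2)] by (simp add: closedin_def)
      show "disjnt (hc_lift G V) (arr (hausdorff_cover G) - hc_lift G K)"
        using VK(4) by (auto simp: hc_lift_def disjnt_def)
    qed (use A B a VK in \<open>auto simp: hc_lift_def\<close>)
  qed
  show ?thesis
    unfolding Hausdorff_space_def topspace_hcover_top
  proof (intro allI impI, elim conjE)
    fix A B assume AB: "A \<in> arr (hausdorff_cover G)" "B \<in> arr (hausdorff_cover G)" "A \<noteq> B"
    then consider a where "a \<in> A" "a \<notin> B" | b where "b \<in> B" "b \<notin> A" by blast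
    then show "\<exists>V W. openin (hcover_top G) V \<and> openin (hcover_top G) W \<and> A \<in> V \<and> B \<in> W \<and> disjnt V W"
    proof cases
      case 1
      then show ?thesis using sep AB by blast
    next
      case 2
      then show ?thesis using sep[OF AB(2,1)] by (meson disjnt_sym)
    qed
  qed
qed

text \<open>This is the accumulation argument in contrapositive form: if singletons
  \<open>{h}\<close> in \<open>\<C>\<close> existed with \<open>h\<close> arbitrarily near
  \<open>g\<close>, a member of \<open>\<C>\<close> would contain \<open>g\<close>. Each member
  misses a compact neighbourhood of \<open>g\<close>, finitely many such neighbourhoods serve all of
  \<open>\<C>\<close>, and their interiors are intersected.\<close>

lemma neighbourhood_avoiding_compact:
  assumes C: "compactin (hcover_top G) \<C>" and g: "g \<in> arr G" and gC: "\<And>A. A \<in> \<C> \<Longrightarrow> g \<notin> A"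
  obtains N where "openin (gtop G) N" "g \<in> N" "\<And>h. h \<in> N \<Longrightarrow> {h} \<notin> \<C>"
proof -
  define \<K> where "\<K> = {K. compactin (gtop G) K \<and> (\<exists>V. openin (gtop G) V \<and> g \<in> V \<and> V \<subseteq> K)}"
  let ?miss = "\<lambda>K. arr (hausdorff_cover G) - hc_lift G K"
  have arrC: "\<C> \<subseteq> arr (hausdorff_cover G)"
    using compactin_subset_topspace[OF C] by simp
  have "\<C> \<subseteq> \<Union>(?miss ` \<K>)"
  proof
    fix A assume A: "A \<in> \<C>"
    then obtain V K where "openin (gtop G) V" "compactin (gtop G) K" "g \<in> V" "V \<subseteq> K" "A \<inter> K = {}"
      using obtain_neighbourhood_missing[of A g] arrC g gC by blast
    then show "A \<in> \<Union>(?miss ` \<K>)"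
      using A arrC by (auto simp: \<K>_def hc_lift_def)
  qed
  moreover have "openin (hcover_top G) U" if "U \<in> ?miss ` \<K>" for U
    using that closedin_hc_lift[of G] by (auto simp: \<K>_def closedin_def)
  ultimately obtain \<F> where \<F>: "finite \<F>" "\<F> \<subseteq> ?miss ` \<K>" "\<C> \<subseteq> \<Union>\<F>"
    using compactinD[OF C, of "?miss ` \<K>"] by metis
  then obtain \<K>' where K': "finite \<K>'" "\<K>' \<subseteq> \<K>" "\<F> = ?miss ` \<K>'"
    by (meson finite_subset_image)
  have "\<forall>K\<in>\<K>'. \<exists>V. openin (gtop G) V \<and> g \<in> V \<and> V \<subseteq> K"
    using K'(2) by (auto simp: \<K>_def)
  then obtain v where v: "\<And>K. K \<in> \<K>' \<Longrightarrow> openin (gtop G) (v K) \<and> g \<in> v K \<and> v K \<subseteq> K"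
    by metis
  \<comment> \<open>The whole space is inserted so that the intersection remains an open set of
    \<open>G\<close> when \<open>\<K>'\<close> is empty.\<close>
  let ?N = "\<Inter>(insert (topspace (gtop G)) (v ` \<K>'))"
  show ?thesis
  proof
    show "openin (gtop G) ?N" using K'(1) v by (intro openin_Inter) auto
    show "g \<in> ?N" using g v by (auto simp: arr_def)
    fix h assume h: "h \<in> ?N"
    show "{h} \<notin> \<C>"
    proof
      assume "{h} \<in> \<C>"
      then obtain K where K: "K \<in> \<K>'" "{h} \<in> ?miss K" using \<F>(3) K'(3) by auto
      then have "h \<notin> K" by (auto simp: hc_lift_def)
      moreover have "h \<in> K" using h K(1) v[OF K(1)] by auto
      ultimately show False by simp
    qed
  qed
qed

end

section \<open>Fibrewise sums, with coefficients general enough for both algebras\<close>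

definition hc_sum :: "'g tgroupoid \<Rightarrow> ('g \<Rightarrow> 'b::comm_monoid_add) \<Rightarrow> 'g set \<Rightarrow> 'b" where
  "hc_sum G f = (\<lambda>A. if A \<in> arr (hausdorff_cover G) then supp_sum f A else 0)"

text \<open>Over an infinite support \<open>supp_sum\<close> takes the default value 0, so
  additivity of \<open>hc_sum\<close> is only available under this condition.\<close>

definition hc_finite :: "'g tgroupoid \<Rightarrow> ('g \<Rightarrow> 'b::zero) \<Rightarrow> bool" where
  "hc_finite G f \<longleftrightarrow> (\<forall>A \<in> arr (hausdorff_cover G). finite {g \<in> A. f g \<noteq> 0})"

lemma hc_map_eq_hc_sum: "hc_map G = hc_sum G"
  by (simp add: fun_eq_iff hc_map_def hc_sum_def)

lemma hc_finite_zero: "hc_finite G (\<lambda>_. 0)"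
  by (simp add: hc_finite_def)

lemma hc_sum_zero: "hc_sum G (\<lambda>_. 0) = (\<lambda>_. 0)"
  by (simp add: hc_sum_def fun_eq_iff supp_sum_def)

lemma hc_finite_combine:
  assumes "hc_finite G f" "hc_finite G h" "p 0 0 = 0"
  shows "hc_finite G (\<lambda>x. p (f x) (h x))"
  unfolding hc_finite_def
proof
  fix A assume A: "A \<in> arr (hausdorff_cover G)"
  have "finite ({g \<in> A. f g \<noteq> 0} \<union> {g \<in> A. h g \<noteq> 0})"
    using assms A by (simp add: hc_finite_def)
  then show "finite {g \<in> A. p (f g) (h g) \<noteq> 0}"
    by (rule rev_finite_subset) (use assms(3) in auto)
qed

lemma hc_sum_add:
  assumes "hc_finite G f" "hc_finite G h"
  shows "hc_sum G (\<lambda>x. f x + h x) = (\<lambda>A. hc_sum G f A + hc_sum G h A)"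
proof
  fix A
  show "hc_sum G (\<lambda>x. f x + h x) A = hc_sum G f A + hc_sum G h A"
  proof (cases "A \<in> arr (hausdorff_cover G)")
    case True
    let ?B = "{g \<in> A. f g \<noteq> 0} \<union> {g \<in> A. h g \<noteq> 0}"
    have B: "finite ?B" using assms True by (simp add: hc_finite_def)
    have "supp_sum (\<lambda>x. f x + h x) A = sum (\<lambda>x. f x + h x) ?B"
      by (rule supp_sum_eq_sum[OF B]) auto
    also have "\<dots> = supp_sum f A + supp_sum h A"
      unfolding sum.distrib
      by (intro arg_cong2[where f = "(+)"] supp_sum_eq_sum[OF B, symmetric]) auto
    finally show ?thesis using True by (simp add: hc_sum_def)
  qed (simp add: hc_sum_def)
qed

lemma hc_sum_diff:
  fixes f h :: "'g \<Rightarrow> 'b::ab_group_add"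
  assumes "hc_finite G f" "hc_finite G h"
  shows "hc_sum G (\<lambda>x. f x - h x) = (\<lambda>A. hc_sum G f A - hc_sum G h A)"
proof -
  have "hc_finite G (\<lambda>x. f x - h x)" by (rule hc_finite_combine) (use assms in auto)
  from hc_sum_add[OF this assms(2)] show ?thesis by (simp add: fun_eq_iff)
qed

lemma decomposable_iff:
  assumes "\<And>A. A \<notin> arr (hausdorff_cover G) \<Longrightarrow> F A = 0"
  shows "decomposable G F \<longleftrightarrow> hc_finite G (\<lambda>g. F {g}) \<and> F = hc_sum G (\<lambda>g. F {g})"
  using assms by (auto simp: decomposable_def hc_finite_def hc_sum_def fun_eq_iff)

context etale_groupoid
begin

lemma hc_sum_singleton:
  assumes "g \<in> arr G"
  shows "hc_sum G f {g} = f g"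
  using singleton_in_hausdorff_cover[OF assms] supp_sum_eq_sum[of "{g}" "{g}" f]
  by (auto simp: hc_sum_def)

lemma hc_sum_point:
  assumes "A \<in> arr (hausdorff_cover G)" "g \<in> A" "\<And>x. x \<in> A \<Longrightarrow> x \<noteq> g \<Longrightarrow> f x = 0"
  shows "hc_sum G f A = f g"
  using assms supp_sum_eq_sum[of "{g}" A f] by (auto simp: hc_sum_def)

lemma hc_finite_bisection:
  assumes "open_bisection G U" "\<And>x. x \<notin> U \<Longrightarrow> f x = 0"
  shows "hc_finite G f"
  unfolding hc_finite_def
proof
  fix A assume A: "A \<in> arr (hausdorff_cover G)"
  show "finite {g \<in> A. f g \<noteq> 0}"
  proof (cases "{g \<in> A. f g \<noteq> 0} = {}")
    case False
    then obtain a where "a \<in> A" "f a \<noteq> 0" by blast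
    then have "{g \<in> A. f g \<noteq> 0} \<subseteq> {a}"
      using at_most_one_in_bisection[OF A _ _ assms(1)] assms(2) by blast
    then show ?thesis using finite_subset by blast
  next
    case True
    then show ?thesis by (simp only: finite.emptyI)
  qed
qed

text \<open>The value at \<open>A\<close> is that of \<open>f\<close> at the only point of
  \<open>A\<close> in \<open>U\<close>, or 0 if there is none. For open \<open>S\<close> without 0
  the preimage consists of the \<open>A\<close> hitting an open set; for \<open>S\<close> containing
  0 it consists of the \<open>A\<close> missing the compact set of points of \<open>K\<close> sent
  outside \<open>S\<close>.\<close>

lemma hc_sum_continuous:
  assumes U: "open_bisection G U" and K: "compactin (gtop G) K" "K \<subseteq> U"
    and f0: "\<And>x. x \<notin> K \<Longrightarrow> f x = 0"
    and f: "continuous_map (subtopology (gtop G) U) T f" and T: "0 \<in> topspace T"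
  shows "continuous_map (hcover_top G) T (hc_sum G f)"
  unfolding continuous_map_def topspace_hcover_top
proof (intro conjI allI impI)
  have oU: "openin (gtop G) U" using U by (simp add: open_bisection_def)
  then have UG: "U \<subseteq> topspace (gtop G)" by (rule openin_subset)
  have val: "hc_sum G f A = f a" if "A \<in> arr (hausdorff_cover G)" "a \<in> A" "a \<in> U" for A a
  proof (rule hc_sum_point[OF that(1,2)])
    fix x assume "x \<in> A" "x \<noteq> a"
    then have "x \<notin> U" using at_most_one_in_bisection[OF that(1) _ that(2) U] that(3) by blast
    then show "f x = 0" using f0 K(2) by blast
  qed
  have val0: "hc_sum G f A = 0" if "A \<in> arr (hausdorff_cover G)" "A \<inter> U = {}" for A
  proof -
    have "{a \<in> A. f a \<noteq> 0} = {}" using that f0 K(2) by blast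
    then show ?thesis by (simp add: hc_sum_def supp_sum_def support_on_def)
  qed
  have fT: "f x \<in> topspace T" if "x \<in> U" for x
    using continuous_map_image_subset_topspace[OF f] UG that by auto
  show "hc_sum G f \<in> arr (hausdorff_cover G) \<rightarrow> topspace T"
  proof
    fix A assume A: "A \<in> arr (hausdorff_cover G)"
    show "hc_sum G f A \<in> topspace T"
    proof (cases "A \<inter> U = {}")
      case True
      then show ?thesis using val0[OF A] T by simp
    next
      case False
      then show ?thesis using val[OF A] fT by auto
    qed
  qed
  fix S assume S: "openin T S"
  have "openin (subtopology (gtop G) U) {x \<in> topspace (subtopology (gtop G) U). f x \<in> S}"
    by (rule openin_continuous_map_preimage[OF f S])
  moreover have "{x \<in> topspace (subtopology (gtop G) U). f x \<in> S} = {x \<in> U. f x \<in> S}"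
    using UG by auto
  ultimately have o: "openin (gtop G) {x \<in> U. f x \<in> S}"
    using openin_open_subtopology[OF oU] by auto
  show "openin (hcover_top G) {A \<in> arr (hausdorff_cover G). hc_sum G f A \<in> S}"
  proof (cases "0 \<in> S")
    case False
    have "{A \<in> arr (hausdorff_cover G). hc_sum G f A \<in> S} = hc_lift G {x \<in> U. f x \<in> S}"
    proof (intro equalityI subsetI)
      fix A assume A: "A \<in> {A \<in> arr (hausdorff_cover G). hc_sum G f A \<in> S}"
      then have "A \<inter> U \<noteq> {}" using val0[of A] False by auto
      then show "A \<in> hc_lift G {x \<in> U. f x \<in> S}" using A val[of A] by (auto simp: hc_lift_def)
    qed (use val in \<open>auto simp: hc_lift_def\<close>)
    then show ?thesis using openin_hc_lift[OF o] by simp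
  next
    case True
    let ?K = "{x \<in> K. f x \<notin> S}"
    have "closedin (subtopology (gtop G) U) {x \<in> topspace (subtopology (gtop G) U). f x \<in> topspace T - S}"
      using S by (intro closedin_continuous_map_preimage[OF f]) auto
    moreover have "compactin (subtopology (gtop G) U) K" using K by (simp add: compactin_subtopology)
    ultimately have "compactin (subtopology (gtop G) U)
        (K \<inter> {x \<in> topspace (subtopology (gtop G) U). f x \<in> topspace T - S})"
      by (rule compact_Int_closedin[rotated])
    moreover have "K \<inter> {x \<in> topspace (subtopology (gtop G) U). f x \<in> topspace T - S} = ?K"
      using UG K(2) fT by auto
    ultimately have cK: "compactin (gtop G) ?K" by (simp add: compactin_subtopology)
    have "{A \<in> arr (hausdorff_cover G). hc_sum G f A \<in> S} = arr (hausdorff_cover G) - hc_lift G ?K"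
    proof (intro equalityI subsetI)
      fix A assume A: "A \<in> {A \<in> arr (hausdorff_cover G). hc_sum G f A \<in> S}"
      then show "A \<in> arr (hausdorff_cover G) - hc_lift G ?K"
        using val[of A] K(2) by (auto simp: hc_lift_def)
    next
      fix A assume A: "A \<in> arr (hausdorff_cover G) - hc_lift G ?K"
      show "A \<in> {A \<in> arr (hausdorff_cover G). hc_sum G f A \<in> S}"
      proof (cases "A \<inter> U = {}")
        case True
        then show ?thesis using A val0[of A] \<open>0 \<in> S\<close> by auto
      next
        case False
        then obtain a where a: "a \<in> A" "a \<in> U" by blast
        then have "a \<notin> ?K" using A by (auto simp: hc_lift_def)
        then have "f a \<in> S" using f0 \<open>0 \<in> S\<close> by (cases "a \<in> K") auto
        then show ?thesis using A val[of A, OF _ a] by auto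
      qed
    qed
    then show ?thesis using closedin_hc_lift[OF cK] by (simp add: closedin_def)
  qed
qed

text \<open>
  The hypothesis on the support of \<open>f\<close> confines the sum over a limit \<open>A\<close> of points of \<open>U - V\<close> to
  the single point of \<open>A\<close> in \<open>U\<close>.
\<close>

lemma continuous_map_off_open:
  assumes U: "open_bisection G U" and V: "openin (gtop G) V"
    and f0: "\<And>x. x \<notin> U \<union> V \<Longrightarrow> f x = 0"
    and F: "continuous_map (hcover_top G) T (hc_sum G f)"
  shows "continuous_map (subtopology (gtop G) (U - V)) T f"
proof -
  have oU: "openin (gtop G) U" using U by (simp add: open_bisection_def)
  have UG: "U \<subseteq> arr G" using openin_subset[OF oU] by (simp add: arr_def)
  have top: "topspace (subtopology (gtop G) (U - V)) = U - V"
    using UG by (auto simp: arr_def)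
  have Ff: "hc_sum G f {x} = f x" if "x \<in> U" for x using hc_sum_singleton UG that by blast
  show ?thesis
    unfolding continuous_map_def top
  proof (intro conjI allI impI)
    have "hc_sum G f {x} \<in> topspace T" if "x \<in> U" for x
      using continuous_map_image_subset_topspace[OF F] singleton_in_hausdorff_cover[of x] UG that
      by auto
    then show "f \<in> U - V \<rightarrow> topspace T" using Ff by auto
  next
    fix S assume S: "openin T S"
    show "openin (subtopology (gtop G) (U - V)) {x \<in> U - V. f x \<in> S}"
    proof (subst openin_subopen, intro ballI)
      fix g assume "g \<in> {x \<in> U - V. f x \<in> S}"
      then have g: "g \<in> U" "g \<notin> V" "f g \<in> S" by auto
      then have gG: "g \<in> arr G" using UG by blast
      obtain U' W K where W: "openin (gtop G) W" "compactin (gtop G) K" "g \<in> W" "W \<subseteq> K" "K \<subseteq> U'" "U' \<subseteq> U"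
        using obtain_compact_neighbourhood[OF oU g(1)] by metis
      \<comment> \<open>For \<open>h \<in> W \<inter> (U - V)\<close> the singleton
        \<open>{h}\<close> lies in \<open>\<C>\<close> exactly when \<open>f h \<notin> S\<close>.
        So continuity at \<open>g\<close> amounts to keeping these singletons out of
        \<open>\<C>\<close> for \<open>h\<close> near \<open>g\<close>.\<close>
      define \<C> where "\<C> = hc_lift G K \<inter> ({A \<in> topspace (hcover_top G). hc_sum G f A \<in> topspace T - S}
          \<inter> (topspace (hcover_top G) - hc_lift G V))"
      have "closedin (hcover_top G) {A \<in> topspace (hcover_top G). hc_sum G f A \<in> topspace T - S}"
        using S by (intro closedin_continuous_map_preimage[OF F]) auto
      moreover have "closedin (hcover_top G) (topspace (hcover_top G) - hc_lift G V)"
        using openin_hc_lift[OF V] by blast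
      ultimately have "compactin (hcover_top G) \<C>"
        unfolding \<C>_def by (intro compact_Int_closedin compactin_hc_lift W closedin_Int)
      moreover have "g \<notin> A" if A: "A \<in> \<C>" for A
      proof
        assume gA: "g \<in> A"
        have A': "A \<in> arr (hausdorff_cover G)" "A \<inter> V = {}" "hc_sum G f A \<notin> S"
          using A by (auto simp: \<C>_def hc_lift_def)
        have "hc_sum G f A = f g"
        proof (rule hc_sum_point[OF A'(1) gA])
          fix x assume x: "x \<in> A" "x \<noteq> g"
          then have "x \<notin> U" using at_most_one_in_bisection[OF A'(1) x(1) gA U] g(1) by blast
          then show "f x = 0" using f0 x A'(2) by blast
        qed
        then show False using A'(3) g(3) by simp
      qed
      ultimately obtain N where N: "openin (gtop G) N" "g \<in> N" "\<And>h. h \<in> N \<Longrightarrow> {h} \<notin> \<C>"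
        using neighbourhood_avoiding_compact[OF _ gG] by metis
      show "\<exists>T. openin (subtopology (gtop G) (U - V)) T \<and> g \<in> T \<and> T \<subseteq> {x \<in> U - V. f x \<in> S}"
      proof (intro exI conjI)
        show "openin (subtopology (gtop G) (U - V)) ((N \<inter> W) \<inter> (U - V))"
          by (rule openin_subtopology_Int[OF openin_Int[OF N(1) W(1)]])
        show "g \<in> (N \<inter> W) \<inter> (U - V)" using N W g by blast
        show "(N \<inter> W) \<inter> (U - V) \<subseteq> {x \<in> U - V. f x \<in> S}"
        proof
          fix h assume h: "h \<in> (N \<inter> W) \<inter> (U - V)"
          then have hG: "{h} \<in> arr (hausdorff_cover G)"
            using UG by (intro singleton_in_hausdorff_cover) blast
          then have "hc_sum G f {h} \<in> topspace T"
            using continuous_map_image_subset_topspace[OF F] by auto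
          moreover have "{h} \<notin> \<C>" using N h by blast
          ultimately have "hc_sum G f {h} \<in> S"
            using hG h W(4) by (auto simp: \<C>_def hc_lift_def)
          then show "h \<in> {x \<in> U - V. f x \<in> S}" using h Ff by auto
        qed
      qed
    qed
  qed
qed

text \<open>The induction on the number of sets, with \<open>L\<close> and \<open>T\<close> standing
  for \<open>span_Cc G\<close> and the Euclidean topology, or for \<open>steinberg G\<close> and the
  discrete one. The function \<open>h\<close> from \<open>step\<close> agrees with \<open>f\<close>
  outside the union of the remaining sets; by \<open>finL\<close> and \<open>contL\<close> the
  difference \<open>f - h\<close> satisfies the same hypotheses and vanishes outside that
  union.\<close>

lemma peel_off_bisections:
  fixes L :: "('a \<Rightarrow> 'b::ab_group_add) set"
  assumes zero: "(\<lambda>_. 0) \<in> L" and add: "\<And>f h. f \<in> L \<Longrightarrow> h \<in> L \<Longrightarrow> (\<lambda>x. f x + h x) \<in> L"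
    and finL: "\<And>h. h \<in> L \<Longrightarrow> hc_finite G h"
    and contL: "\<And>h. h \<in> L \<Longrightarrow> continuous_map (hcover_top G) T (hc_sum G h)"
    and diff: "\<And>F H. continuous_map (hcover_top G) T F \<Longrightarrow> continuous_map (hcover_top G) T H
                 \<Longrightarrow> continuous_map (hcover_top G) T (\<lambda>A. F A - H A)"
    and openU: "\<And>U. U \<in> \<U> \<Longrightarrow> openin (gtop G) U"
    and step: "\<And>U V f. U \<in> \<U> \<Longrightarrow> openin (gtop G) V \<Longrightarrow> continuous_map (hcover_top G) T (hc_sum G f)
                 \<Longrightarrow> (\<And>x. x \<notin> U \<union> V \<Longrightarrow> f x = 0) \<Longrightarrow> \<exists>h\<in>L. \<forall>x. x \<notin> V \<longrightarrow> h x = f x"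
    and "finite \<U>" "hc_finite G f" "continuous_map (hcover_top G) T (hc_sum G f)"
    and "\<And>x. x \<notin> \<Union>\<U> \<Longrightarrow> f x = 0"
  shows "f \<in> L"
  \<comment> \<open>The facts \<open>openU\<close> and \<open>step\<close> mention
    \<open>\<U>\<close> and must shrink with it; \<open>assms(9-)\<close> are the three facts about
    the varying \<open>f\<close>.\<close>
  using \<open>finite \<U>\<close> openU step assms(9-)
proof (induction \<U> arbitrary: f rule: finite_induct)
  case empty
  then have "f = (\<lambda>_. 0)" by auto
  then show ?case using zero by simp
next
  case (insert U \<U>)
  have "openin (gtop G) (\<Union>\<U>)" using insert.prems(1) by blast
  then obtain h where h: "h \<in> L" "\<And>x. x \<notin> \<Union>\<U> \<Longrightarrow> h x = f x"
    using insert.prems(2)[of U "\<Union>\<U>" f] insert.prems(4,5) by auto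
  have "(\<lambda>x. f x - h x) \<in> L"
  proof (rule insert.IH)
    show "hc_finite G (\<lambda>x. f x - h x)"
      by (rule hc_finite_combine[OF insert.prems(3) finL[OF h(1)]]) simp
    show "continuous_map (hcover_top G) T (hc_sum G (\<lambda>x. f x - h x))"
      unfolding hc_sum_diff[OF insert.prems(3) finL[OF h(1)]]
      by (rule diff[OF insert.prems(4) contL[OF h(1)]])
    show "\<exists>h\<in>L. \<forall>x. x \<notin> V \<longrightarrow> h x = f x"
      if "U' \<in> \<U>" "openin (gtop G) V" "continuous_map (hcover_top G) T (hc_sum G f)"
        "\<And>x. x \<notin> U' \<union> V \<Longrightarrow> f x = 0" for U' V f
      by (rule insert.prems(2)[OF insertI2[OF that(1)] that(2-4)])
    show "openin (gtop G) U'" if "U' \<in> \<U>" for U'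
      by (rule insert.prems(1)[OF insertI2[OF that]])
    show "f x - h x = 0" if "x \<notin> \<Union>\<U>" for x using h(2)[OF that] by simp
  qed
  then show ?case using add[OF _ h(1), of "\<lambda>x. f x - h x"] by simp
qed

text \<open>Members of the cover are nonempty, so the lifts of the sets satisfying \<open>P\<close>
  form an open cover of \<open>S\<close>. The predicate is left open because the two cases need
  different kinds of small sets.\<close>

lemma hc_lift_cover:
  assumes S: "compactin (hcover_top G) S" and base: "\<And>g. g \<in> arr G \<Longrightarrow> \<exists>U. P U \<and> g \<in> U"
    and open_P: "\<And>U. P U \<Longrightarrow> openin (gtop G) U"
  obtains \<U> where "finite \<U>" "\<And>U. U \<in> \<U> \<Longrightarrow> P U" "S \<subseteq> hc_lift G (\<Union>\<U>)"
proof -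
  have SG: "S \<subseteq> arr (hausdorff_cover G)" using compactin_subset_topspace[OF S] by simp
  have "S \<subseteq> \<Union>(hc_lift G ` Collect P)"
  proof
    fix A assume A: "A \<in> S"
    then obtain a where a: "a \<in> A" using hausdorff_cover_nonempty SG by blast
    then have "a \<in> arr G" using hausdorff_cover_subset A SG by blast
    then obtain U where "P U" "a \<in> U" using base by blast
    then show "A \<in> \<Union>(hc_lift G ` Collect P)" using A SG a by (auto simp: hc_lift_def)
  qed
  moreover have "openin (hcover_top G) W" if "W \<in> hc_lift G ` Collect P" for W
    using that openin_hc_lift open_P by auto
  ultimately obtain \<F> where \<F>: "finite \<F>" "\<F> \<subseteq> hc_lift G ` Collect P" "S \<subseteq> \<Union>\<F>"
    using compactinD[OF S, of "hc_lift G ` Collect P"] by metis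
  then obtain \<U> where "finite \<U>" "\<U> \<subseteq> Collect P" "\<F> = hc_lift G ` \<U>"
    by (meson finite_subset_image)
  moreover from this have "S \<subseteq> hc_lift G (\<Union>\<U>)" using \<F>(3) by (auto simp: hc_lift_def)
  ultimately show ?thesis using that[of \<U>] by auto
qed

text \<open>Evaluation at singletons recovers \<open>f\<close> from \<open>hc_sum G f\<close>, so
  the only possible preimage of \<open>F\<close> in \<open>L\<close> is the function sending
  \<open>g\<close> to \<open>F {g}\<close>. What remains is the membership of this function in
  \<open>L\<close>, which is delegated to \<open>surj\<close>.\<close>

lemma image_hc_sum_iff_decomposable:
  assumes F0: "\<And>A. A \<notin> arr (hausdorff_cover G) \<Longrightarrow> F A = 0"
    and finL: "\<And>f. f \<in> L \<Longrightarrow> hc_finite G f"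
    and L0: "\<And>f x. f \<in> L \<Longrightarrow> x \<notin> arr G \<Longrightarrow> f x = 0"
    and surj: "\<And>f. hc_finite G f \<Longrightarrow> (\<And>x. x \<notin> arr G \<Longrightarrow> f x = 0) \<Longrightarrow> hc_sum G f = F \<Longrightarrow> f \<in> L"
  shows "F \<in> hc_sum G ` L \<longleftrightarrow> decomposable G F"
proof -
  have notin: "{g} \<notin> arr (hausdorff_cover G)" if "g \<notin> arr G" for g
    using hausdorff_cover_subset[of "{g}" G] that by blast
  have "decomposable G F \<longleftrightarrow> hc_finite G (\<lambda>g. F {g}) \<and> F = hc_sum G (\<lambda>g. F {g})"
    by (rule decomposable_iff) (rule F0)
  moreover have "F \<in> hc_sum G ` L \<longleftrightarrow> hc_finite G (\<lambda>g. F {g}) \<and> F = hc_sum G (\<lambda>g. F {g})"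
  proof
    assume "F \<in> hc_sum G ` L"
    then obtain f where f: "f \<in> L" "F = hc_sum G f" by blast
    have "F {g} = f g" for g
    proof (cases "g \<in> arr G")
      case True
      then show ?thesis using hc_sum_singleton f by simp
    next
      case False
      then show ?thesis using F0[OF notin] L0[OF f(1)] by simp
    qed
    then show "hc_finite G (\<lambda>g. F {g}) \<and> F = hc_sum G (\<lambda>g. F {g})"
      using f finL by simp
  next
    assume dec: "hc_finite G (\<lambda>g. F {g}) \<and> F = hc_sum G (\<lambda>g. F {g})"
    then have "(\<lambda>g. F {g}) \<in> L"
      using F0[OF notin] by (intro surj) auto
    then show "F \<in> hc_sum G ` L" using dec by blast
  qed
  ultimately show ?thesis by simp
qed

end

section \<open>The complex case\<close>

lemma continuous_map_closed_Un:
  assumes S: "closedin X S" and T: "closedin X T" and ST: "S \<union> T = topspace X"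
    and fS: "continuous_map (subtopology X S) Y f" and fT: "continuous_map (subtopology X T) Y f"
  shows "continuous_map X Y f"
  unfolding continuous_map_closedin
proof (intro conjI allI impI)
  have top: "topspace (subtopology X S) = S" "topspace (subtopology X T) = T"
    using closedin_subset[OF S] closedin_subset[OF T] by auto
  show "f \<in> topspace X \<rightarrow> topspace Y"
    using continuous_map_image_subset_topspace[OF fS] continuous_map_image_subset_topspace[OF fT]
    unfolding ST[symmetric] top by blast
  fix C assume C: "closedin Y C"
  have "closedin X {x \<in> S. f x \<in> C}"
    using closedin_trans_full[OF closedin_continuous_map_preimage[OF fS C] S] unfolding top .
  moreover have "closedin X {x \<in> T. f x \<in> C}"
    using closedin_trans_full[OF closedin_continuous_map_preimage[OF fT C] T] unfolding top .
  ultimately have "closedin X ({x \<in> S. f x \<in> C} \<union> {x \<in> T. f x \<in> C})"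
    by (rule closedin_Un)
  moreover have "{x \<in> S. f x \<in> C} \<union> {x \<in> T. f x \<in> C} = {x \<in> topspace X. f x \<in> C}"
    using ST by auto
  ultimately show "closedin X {x \<in> topspace X. f x \<in> C}" by simp
qed

lemma Tietze_extension_complex:
  fixes f :: "'a \<Rightarrow> complex"
  assumes "normal_space X" "closedin X S" "continuous_map (subtopology X S) euclidean f"
  obtains g where "continuous_map X euclidean g" "\<And>x. x \<in> S \<Longrightarrow> g x = f x"
proof -
  have "continuous_map (subtopology X S) euclideanreal (\<lambda>x. Re (f x))"
    using continuous_map_compose[OF assms(3), of euclideanreal Re]
    by (simp add: o_def continuous_on_Re)
  then obtain g1 where g1: "continuous_map X euclideanreal g1" "\<And>x. x \<in> S \<Longrightarrow> g1 x = Re (f x)"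
    using Tietze_extension_realinterval[OF assms(1,2) is_interval_univ UNIV_not_empty]
    by (metis subset_UNIV)
  have "continuous_map (subtopology X S) euclideanreal (\<lambda>x. Im (f x))"
    using continuous_map_compose[OF assms(3), of euclideanreal Im]
    by (simp add: o_def continuous_on_Im)
  then obtain g2 where g2: "continuous_map X euclideanreal g2" "\<And>x. x \<in> S \<Longrightarrow> g2 x = Im (f x)"
    using Tietze_extension_realinterval[OF assms(1,2) is_interval_univ UNIV_not_empty]
    by (metis subset_UNIV)
  have of_real: "continuous_map X euclidean (\<lambda>x. complex_of_real (u x))"
    if "continuous_map X euclideanreal u" for u
    using continuous_map_compose[OF that, of euclidean complex_of_real]
    by (simp add: o_def continuous_on_of_real)
  have "continuous_map X euclidean (\<lambda>x. \<i> * complex_of_real (g2 x))"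
    using continuous_map_compose[OF of_real[OF g2(1)], of euclidean "(*) \<i>"]
    by (simp add: o_def continuous_on_mult_left)
  then have "continuous_map X euclidean (\<lambda>x. complex_of_real (g1 x) + \<i> * complex_of_real (g2 x))"
    by (rule continuous_map_add[OF of_real[OF g1(1)]])
  then show ?thesis
    by (rule that) (simp add: g1(2) g2(2) complex_eq_iff)
qed

section \<open>Compactly supported functions on bisections and their span\<close>

lemma CcE:
  assumes "h \<in> Cc (subtopology X U)"
  obtains K where "compactin X K" "K \<subseteq> U" "\<And>x. x \<notin> K \<Longrightarrow> h x = 0"
    "continuous_map (subtopology X U) euclidean h"
proof -
  let ?Y = "subtopology X U"
  let ?K = "?Y closure_of {x \<in> topspace ?Y. h x \<noteq> 0}"
  have h: "continuous_map ?Y euclidean h" "compactin ?Y ?K" "\<And>x. x \<notin> topspace ?Y \<Longrightarrow> h x = 0"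
    using assms by (auto simp: Cc_def)
  have sub: "{x \<in> topspace ?Y. h x \<noteq> 0} \<subseteq> ?K" by (rule closure_of_subset) auto
  show ?thesis
  proof
    show "compactin X ?K" "?K \<subseteq> U" using h(2) unfolding compactin_subtopology by auto
    show "h x = 0" if "x \<notin> ?K" for x
    proof (cases "x \<in> topspace ?Y")
      case True
      then show ?thesis using sub that by blast
    qed (rule h(3))
  qed (rule h(1))
qed

lemma span_Cc_zero: "(\<lambda>_. 0) \<in> span_Cc G"
  unfolding span_Cc_def by (intro CollectI exI[of _ 0]) auto

lemma span_Cc_add_Cc:
  assumes f: "f \<in> span_Cc G" and U: "open_bisection G U" and h: "h \<in> Cc (subtopology (gtop G) U)"
  shows "(\<lambda>x. f x + c * h x) \<in> span_Cc G"
proof -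
  obtain n :: nat and a k where k: "\<forall>i<n. \<exists>U. open_bisection G U \<and> k i \<in> Cc (subtopology (gtop G) U)"
    "f = (\<lambda>x. \<Sum>i<n. a i * k i x)"
    using f unfolding span_Cc_def by blast
  have "\<forall>i<Suc n. \<exists>U. open_bisection G U \<and> (k(n := h)) i \<in> Cc (subtopology (gtop G) U)"
    using k(1) U h by (auto simp: less_Suc_eq)
  moreover have "(\<lambda>x. f x + c * h x) = (\<lambda>x. \<Sum>i<Suc n. (a(n := c)) i * (k(n := h)) i x)"
    by (simp add: k(2))
  ultimately show ?thesis
    unfolding span_Cc_def by blast
qed

lemma span_Cc_induct [consumes 1, case_names zero add]:
  assumes "f \<in> span_Cc G" and zero: "P (\<lambda>_. 0)"
    and add: "\<And>f c h U. f \<in> span_Cc G \<Longrightarrow> P f \<Longrightarrow> open_bisection G U \<Longrightarrow>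
               h \<in> Cc (subtopology (gtop G) U) \<Longrightarrow> P (\<lambda>x. f x + c * h x)"
  shows "P f"
proof -
  obtain n :: nat and a k where k: "\<forall>i<n. \<exists>U. open_bisection G U \<and> k i \<in> Cc (subtopology (gtop G) U)"
    "f = (\<lambda>x. \<Sum>i<n. a i * k i x)"
    using assms(1) unfolding span_Cc_def by blast
  have "m \<le> n \<Longrightarrow> (\<lambda>x. \<Sum>i<m. a i * k i x) \<in> span_Cc G \<and> P (\<lambda>x. \<Sum>i<m. a i * k i x)" for m
  proof (induction m)
    case 0
    then show ?case using zero span_Cc_zero by simp
  next
    case (Suc m)
    then obtain U where U: "open_bisection G U" "k m \<in> Cc (subtopology (gtop G) U)"
      using k(1) by (meson Suc_le_lessD)
    then show ?case
      using Suc span_Cc_add_Cc[of "\<lambda>x. \<Sum>i<m. a i * k i x" G U "k m" "a m"]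
        add[of "\<lambda>x. \<Sum>i<m. a i * k i x" U "k m" "a m"] by simp
  qed
  then show ?thesis using k(2) by blast
qed

lemma span_Cc_add:
  assumes "f \<in> span_Cc G" "h \<in> span_Cc G"
  shows "(\<lambda>x. f x + h x) \<in> span_Cc G"
  using assms(2)
proof (induction rule: span_Cc_induct)
  case (add h c k U)
  then show ?case
    using span_Cc_add_Cc[of "\<lambda>x. f x + h x" G U k c] by (simp add: add.assoc)
qed (simp add: assms(1))

context etale_groupoid
begin

lemma Cc_bisection:
  fixes h :: "'a \<Rightarrow> complex"
  assumes U: "open_bisection G U" and h: "h \<in> Cc (subtopology (gtop G) U)"
  shows "hc_finite G (\<lambda>x. c * h x)"
    and "continuous_map (hcover_top G) euclidean (hc_sum G (\<lambda>x. c * h x))"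
    and "x \<notin> arr G \<Longrightarrow> h x = 0"
proof -
  obtain K where K: "compactin (gtop G) K" "K \<subseteq> U" "\<And>x. x \<notin> K \<Longrightarrow> h x = 0"
    "continuous_map (subtopology (gtop G) U) euclidean h"
    by (rule CcE[OF h]) blast
  have "h x = 0" if "x \<notin> U" for x using K(2,3) that by blast
  then show "hc_finite G (\<lambda>x. c * h x)" by (intro hc_finite_bisection[OF U]) simp
  have "continuous_map (subtopology (gtop G) U) euclidean (\<lambda>x. c * h x)"
    using continuous_map_compose[OF K(4), of euclidean "(*) c"]
    by (simp add: o_def continuous_on_mult_left)
  then show "continuous_map (hcover_top G) euclidean (hc_sum G (\<lambda>x. c * h x))"
    by (intro hc_sum_continuous[OF U K(1,2)]) (simp_all add: K(3))
  show "h x = 0" if "x \<notin> arr G"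
    using that K(3) compactin_subset_topspace[OF K(1)] by (auto simp: arr_def)
qed

lemma span_Cc_hc_sum:
  assumes "f \<in> span_Cc G"
  shows "hc_finite G f" and "continuous_map (hcover_top G) euclidean (hc_sum G f)"
    and "x \<notin> arr G \<Longrightarrow> f x = 0"
proof -
  have "hc_finite G f \<and> continuous_map (hcover_top G) euclidean (hc_sum G f) \<and> (\<forall>x. x \<notin> arr G \<longrightarrow> f x = 0)"
    using assms
  proof (induction rule: span_Cc_induct)
    case zero
    then show ?case by (simp add: hc_finite_zero hc_sum_zero)
  next
    case (add f c h U)
    have fin: "hc_finite G f" "hc_finite G (\<lambda>x. c * h x)"
      using add.IH Cc_bisection(1)[OF add.hyps(2,3)] by auto
    have "hc_finite G (\<lambda>x. f x + c * h x)"
      by (rule hc_finite_combine[OF fin]) simp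
    moreover have "continuous_map (hcover_top G) euclidean (hc_sum G (\<lambda>x. f x + c * h x))"
      unfolding hc_sum_add[OF fin]
      using add.IH Cc_bisection(2)[OF add.hyps(2,3)] by (intro continuous_map_add) auto
    ultimately show ?case
      using add.IH Cc_bisection(3)[OF add.hyps(2,3)] by simp
  qed
  then show "hc_finite G f" "continuous_map (hcover_top G) euclidean (hc_sum G f)"
    "x \<notin> arr G \<Longrightarrow> f x = 0" by auto
qed

text \<open>\<open>G\<close> need not be normal, so Tietze's theorem is applied inside the compact
  Hausdorff set \<open>K\<close>. The values of \<open>f\<close> are prescribed on
  \<open>K - V\<close> and the value 0 on \<open>K - U\<close>; vanishing on \<open>K - U\<close> is
  what makes the extension by zero continuous on \<open>U'\<close>.\<close>

lemma Cc_extension_off_open: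
  fixes f :: "'a \<Rightarrow> complex"
  assumes U': "open_bisection G U'" and K: "compactin (gtop G) K" "K \<subseteq> U'"
    and U: "openin (gtop G) U" "U \<subseteq> K" and V: "openin (gtop G) V"
    and F: "continuous_map (hcover_top G) euclidean (hc_sum G f)"
    and f0: "\<And>x. x \<notin> U \<union> V \<Longrightarrow> f x = 0"
  shows "\<exists>h \<in> Cc (subtopology (gtop G) U'). \<forall>x. x \<notin> V \<longrightarrow> h x = f x"
proof -
  let ?X = "subtopology (gtop G) U'" and ?Y = "subtopology (gtop G) K"
  have topK: "topspace ?Y = K" using compactin_subset_topspace[OF K(1)] by auto
  have oU': "openin (gtop G) U'" using U' by (simp add: open_bisection_def)
  have topU': "topspace ?X = U'" using openin_subset[OF oU'] by auto
  have HX: "Hausdorff_space ?X" by (rule Hausdorff_space_open_bisection[OF U'])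
  have YX: "?Y = subtopology ?X K" using K(2) by (simp add: subtopology_subtopology inf.absorb2)
  have normal: "normal_space ?Y"
    by (intro compact_Hausdorff_or_regular_imp_normal_space disjI1 compact_space_subtopology K(1))
      (simp add: YX Hausdorff_space_subtopology[OF HX])
  have clV: "closedin ?Y (K - V)" and clU: "closedin ?Y (K - U)"
    using U V topK by (simp_all add: closedin_def double_diff openin_subtopology Diff_Diff_Int)
       (blast intro: Int_commute)+
  define S where "S = (K - V) \<union> (K - U)"
  \<comment> \<open>This equals \<open>f\<close> on \<open>K - V\<close> and 0 on
    \<open>K - U\<close>. The two prescriptions agree on the overlap because \<open>f\<close>
    vanishes outside \<open>U \<union> V\<close>.\<close>
  define f' where "f' = (\<lambda>x. if x \<in> V then 0 else f x)"
  have clS: "closedin ?Y S" unfolding S_def by (rule closedin_Un[OF clV clU])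
  have SK: "S \<subseteq> K" by (auto simp: S_def)
  have "continuous_map (subtopology ?Y S) euclidean f'"
  proof (rule continuous_map_closed_Un)
    show "closedin (subtopology ?Y S) (K - V)" "closedin (subtopology ?Y S) (K - U)"
      using clV clU by (auto intro: closedin_subset_topspace simp: S_def)
    show "(K - V) \<union> (K - U) = topspace (subtopology ?Y S)"
      using topK by (auto simp: S_def)
    have "continuous_map (subtopology (gtop G) (U' - V)) euclidean f"
      using U(2) K(2) f0 by (intro continuous_map_off_open[OF U' V _ F]) blast
    then have "continuous_map (subtopology (gtop G) (K - V)) euclidean f"
      by (rule continuous_map_from_subtopology_mono) (use K(2) in blast)
    then have "continuous_map (subtopology (gtop G) (K - V)) euclidean f'"
      by (rule continuous_map_eq) (simp add: f'_def)
    moreover have "subtopology (subtopology ?Y S) (K - V) = subtopology (gtop G) (K - V)"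
      by (simp add: subtopology_subtopology S_def) (rule arg_cong[where f = "subtopology (gtop G)"], blast)
    ultimately show "continuous_map (subtopology (subtopology ?Y S) (K - V)) euclidean f'" by simp
    show "continuous_map (subtopology (subtopology ?Y S) (K - U)) euclidean f'"
      by (rule continuous_map_eq[of _ _ "\<lambda>_. 0"]) (use f0 in \<open>auto simp: f'_def\<close>)
  qed
  then obtain h0 where h0: "continuous_map ?Y euclidean h0" "\<And>x. x \<in> S \<Longrightarrow> h0 x = f' x"
    using Tietze_extension_complex[OF normal clS] by metis
  define h where "h = (\<lambda>x. if x \<in> K then h0 x else 0)"
  have h0U: "h x = 0" if "x \<notin> U" for x
    using h0(2)[of x] that f0[of x] by (auto simp: h_def f'_def S_def)
  have clK: "closedin ?X K"
    by (rule compactin_imp_closedin[OF HX]) (simp add: compactin_subtopology K)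
  \<comment> \<open>Pasting along \<open>K\<close> and \<open>U' - U\<close>, both closed in
    \<open>U'\<close>: on the first \<open>h\<close> is \<open>h0\<close>, on the second it is
    0.\<close>
  have "continuous_map ?X euclidean h"
  proof (rule continuous_map_closed_Un[OF clK])
    show "closedin ?X (U' - U)"
      using U K(2) topU' by (simp add: closedin_def double_diff openin_open_subtopology oU')
    show "K \<union> (U' - U) = topspace ?X" using topU' U K by auto
    show "continuous_map (subtopology ?X K) euclidean h"
      using h0(1) unfolding YX by (rule continuous_map_eq) (simp add: h_def)
    show "continuous_map (subtopology ?X (U' - U)) euclidean h"
      by (rule continuous_map_eq[of _ _ "\<lambda>_. 0"]) (use h0U in auto)
  qed
  moreover have "compactin ?X (?X closure_of {x \<in> topspace ?X. h x \<noteq> 0})"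
  proof (rule closed_compactin)
    show "compactin ?X K" by (simp add: compactin_subtopology K)
    show "?X closure_of {x \<in> topspace ?X. h x \<noteq> 0} \<subseteq> K"
      by (rule closure_of_minimal[OF _ clK]) (auto simp: h_def split: if_splits)
  qed simp
  moreover have "h x = 0" if "x \<notin> topspace ?X" for x
    using that topU' K(2) by (auto simp: h_def)
  ultimately have "h \<in> Cc ?X" by (simp add: Cc_def)
  moreover have "h x = f x" if "x \<notin> V" for x
  proof (cases "x \<in> K")
    case True
    then show ?thesis using h0(2)[of x] that by (simp add: h_def f'_def S_def)
  next
    case False
    then show ?thesis using f0[of x] that U(2) by (auto simp: h_def)
  qed
  ultimately show ?thesis by blast
qed

lemma decomposable_imp_span_Cc:
  assumes fin: "hc_finite G f" and F: "hc_sum G f \<in> Cc (hcover_top G)"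
    and f0: "\<And>x. x \<notin> arr G \<Longrightarrow> f x = 0"
  shows "f \<in> span_Cc G"
proof -
  have cont: "continuous_map (hcover_top G) euclidean (hc_sum G f)"
    using F by (simp add: Cc_def)
  define S where "S = hcover_top G closure_of {A \<in> topspace (hcover_top G). hc_sum G f A \<noteq> 0}"
  have S: "compactin (hcover_top G) S" using F by (simp add: Cc_def S_def)
  have supp: "{A \<in> topspace (hcover_top G). hc_sum G f A \<noteq> 0} \<subseteq> S"
    unfolding S_def by (rule closure_of_subset) auto
  \<comment> \<open>Each covering set comes with a compact set around it inside a bisection, as
    \<open>Cc_extension_off_open\<close> requires.\<close>
  define P where "P = (\<lambda>U. openin (gtop G) U \<and>
    (\<exists>K U'. compactin (gtop G) K \<and> open_bisection G U' \<and> U \<subseteq> K \<and> K \<subseteq> U'))"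
  have base: "\<exists>U. P U \<and> g \<in> U" if g: "g \<in> arr G" for g
  proof -
    obtain U' V K where "open_bisection G U'" "openin (gtop G) V" "compactin (gtop G) K"
      "g \<in> V" "V \<subseteq> K" "K \<subseteq> U'" "U' \<subseteq> topspace (gtop G)"
      by (rule obtain_compact_neighbourhood[of "topspace (gtop G)" g]) (use g in \<open>simp_all add: arr_def\<close>)
    then show ?thesis unfolding P_def by blast
  qed
  obtain \<U> where \<U>: "finite \<U>" "\<And>U. U \<in> \<U> \<Longrightarrow> P U" "S \<subseteq> hc_lift G (\<Union>\<U>)"
    by (rule hc_lift_cover[OF S base]) (auto simp: P_def)
  show ?thesis
  proof (rule peel_off_bisections[where L = "span_Cc G" and T = euclidean])
    show "continuous_map (hcover_top G) euclidean (\<lambda>A. F A - H A)"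
      if "continuous_map (hcover_top G) euclidean F" "continuous_map (hcover_top G) euclidean H"
      for F H :: "'a set \<Rightarrow> complex"
      using that by (rule continuous_map_diff)
    show "\<exists>h\<in>span_Cc G. \<forall>x. x \<notin> V \<longrightarrow> h x = f x"
      if "U \<in> \<U>" and V: "openin (gtop G) V" "continuous_map (hcover_top G) euclidean (hc_sum G f)"
        "\<And>x. x \<notin> U \<union> V \<Longrightarrow> f x = 0" for U V f
    proof -
      obtain K U' where U: "openin (gtop G) U" "compactin (gtop G) K" "open_bisection G U'" "U \<subseteq> K" "K \<subseteq> U'"
        using \<U>(2)[OF \<open>U \<in> \<U>\<close>] unfolding P_def by blast
      obtain h where h: "h \<in> Cc (subtopology (gtop G) U')" "\<forall>x. x \<notin> V \<longrightarrow> h x = f x"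
        using Cc_extension_off_open[OF U(3,2,5,1,4) V] by blast
      have "h \<in> span_Cc G"
        using span_Cc_add_Cc[OF span_Cc_zero U(3) h(1), of 1] by simp
      then show ?thesis using h(2) by blast
    qed
    show "f x = 0" if x: "x \<notin> \<Union>\<U>" for x
    proof (cases "x \<in> arr G")
      case True
      have "{x} \<notin> S" using \<U>(3) x by (auto simp: hc_lift_def)
      then have "hc_sum G f {x} = 0"
        using supp singleton_in_hausdorff_cover[OF True] by auto
      then show ?thesis using hc_sum_singleton[OF True, of f] by metis
    qed (rule f0)
  qed (use span_Cc_zero span_Cc_add span_Cc_hc_sum \<U>(1,2) fin cont in \<open>auto simp: P_def\<close>)
qed

lemma image_hc_map_iff_decomposable:
  assumes F: "F \<in> Cc (hcover_top G)"
  shows "F \<in> hc_map G ` span_Cc G \<longleftrightarrow> decomposable G F"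
  unfolding hc_map_eq_hc_sum
proof (rule image_hc_sum_iff_decomposable)
  show "F A = 0" if "A \<notin> arr (hausdorff_cover G)" for A
    using F that by (simp add: Cc_def)
  show "f \<in> span_Cc G" if "hc_finite G f" "\<And>x. x \<notin> arr G \<Longrightarrow> f x = 0" "hc_sum G f = F" for f
    using decomposable_imp_span_Cc[of f] that F by blast
qed (use span_Cc_hc_sum in auto)

end

section \<open>The ample case\<close>

text \<open>For a discrete codomain the preimage of any set is a union, over pairs of values, of
  intersections of open fibres. Hence no continuity of \<open>p\<close> is involved; the instances
  used are addition and subtraction.\<close>

lemma continuous_map_discrete_combine:
  assumes f: "continuous_map X (discrete_topology UNIV) f"
    and h: "continuous_map X (discrete_topology UNIV) h"
  shows "continuous_map X (discrete_topology UNIV) (\<lambda>x. p (f x) (h x))"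
  unfolding continuous_map_def
proof (intro conjI allI impI)
  fix S
  have "openin X ({x \<in> topspace X. f x \<in> {a}} \<inter> {x \<in> topspace X. h x \<in> {b}})" for a b
    using openin_continuous_map_preimage[OF f, of "{a}"] openin_continuous_map_preimage[OF h, of "{b}"]
    by (intro openin_Int) auto
  then have "openin X (\<Union>(a, b) \<in> {(a, b). p a b \<in> S}.
      {x \<in> topspace X. f x \<in> {a}} \<inter> {x \<in> topspace X. h x \<in> {b}})"
    by (intro openin_Union) auto
  moreover have "(\<Union>(a, b) \<in> {(a, b). p a b \<in> S}.
      {x \<in> topspace X. f x \<in> {a}} \<inter> {x \<in> topspace X. h x \<in> {b}}) = {x \<in> topspace X. p (f x) (h x) \<in> S}"
    by auto
  ultimately show "openin X {x \<in> topspace X. p (f x) (h x) \<in> S}" by simp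
qed auto

lemma continuous_map_const_on:
  assumes "openin X W" "closedin X W"
  shows "continuous_map X (discrete_topology UNIV) (const_on c W)"
  unfolding continuous_map_def
proof (intro conjI allI impI)
  fix S
  have "W \<subseteq> topspace X" "openin X (topspace X - W)"
    using assms openin_subset by (auto simp: closedin_def)
  moreover have "{x \<in> topspace X. const_on c W x \<in> S} =
      (if c \<in> S then W else {}) \<union> (if 0 \<in> S then topspace X - W else {})"
    using \<open>W \<subseteq> topspace X\<close> by (auto simp: const_on_def)
  ultimately show "openin X {x \<in> topspace X. const_on c W x \<in> S}"
    using assms(1) by auto
qed auto

section \<open>Finite sums of constant functions on compact open bisections\<close>

lemma compact_open_bisection_empty: "compact_open_bisection G {}"
  by (simp add: compact_open_bisection_def open_bisection_def)

lemma steinberg_zero: "(\<lambda>_. 0) \<in> steinberg G"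
  unfolding steinberg_def by (intro CollectI exI[of _ 0]) auto

lemma steinberg_add_const_on:
  assumes f: "f \<in> steinberg G" and W: "compact_open_bisection G W"
  shows "(\<lambda>x. f x + const_on c W x) \<in> steinberg G"
proof -
  obtain n :: nat and a U where U: "\<forall>i<n. compact_open_bisection G (U i)"
    "f = (\<lambda>x. \<Sum>i<n. const_on (a i) (U i) x)"
    using f unfolding steinberg_def by blast
  have "\<forall>i<Suc n. compact_open_bisection G ((U(n := W)) i)"
    using U(1) W by (auto simp: less_Suc_eq)
  moreover have "(\<lambda>x. f x + const_on c W x) = (\<lambda>x. \<Sum>i<Suc n. const_on ((a(n := c)) i) ((U(n := W)) i) x)"
    by (simp add: U(2))
  ultimately show ?thesis
    unfolding steinberg_def by blast
qed

lemma const_on_in_steinberg: "compact_open_bisection G U \<Longrightarrow> const_on c U \<in> steinberg G"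
  using steinberg_add_const_on[OF steinberg_zero, of G U c] by simp

lemma steinberg_induct [consumes 1, case_names zero add]:
  assumes "f \<in> steinberg G" and zero: "P (\<lambda>_. 0)"
    and add: "\<And>f c U. f \<in> steinberg G \<Longrightarrow> P f \<Longrightarrow> compact_open_bisection G U \<Longrightarrow>
               P (\<lambda>x. f x + const_on c U x)"
  shows "P f"
proof -
  obtain n :: nat and a U where U: "\<forall>i<n. compact_open_bisection G (U i)"
    "f = (\<lambda>x. \<Sum>i<n. const_on (a i) (U i) x)"
    using assms(1) unfolding steinberg_def by blast
  have "m \<le> n \<Longrightarrow> (\<lambda>x. \<Sum>i<m. const_on (a i) (U i) x) \<in> steinberg G \<and>
      P (\<lambda>x. \<Sum>i<m. const_on (a i) (U i) x)" for m
  proof (induction m)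
    case 0
    then show ?case using zero steinberg_zero by simp
  next
    case (Suc m)
    then have "compact_open_bisection G (U m)"
      using U(1) by (meson Suc_le_lessD)
    then show ?case
      using Suc steinberg_add_const_on[of "\<lambda>x. \<Sum>i<m. const_on (a i) (U i) x" G "U m" "a m"]
        add[of "\<lambda>x. \<Sum>i<m. const_on (a i) (U i) x" "U m" "a m"] by simp
  qed
  then show ?thesis using U(2) by blast
qed

lemma steinberg_add:
  assumes "f \<in> steinberg G" "h \<in> steinberg G"
  shows "(\<lambda>x. f x + h x) \<in> steinberg G"
  using assms(2)
proof (induction rule: steinberg_induct)
  case (add h c U)
  then show ?case
    using steinberg_add_const_on[of "\<lambda>x. f x + h x" G U c] by (simp add: add.assoc)
qed (simp add: assms(1))

context etale_groupoid
begin

text \<open>A member of the cover meets \<open>U\<close> in at most one point, so the fibrewise sum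
  is \<open>c\<close> or 0. Thus \<open>hc_sum\<close> has the values on generators that
  characterize \<open>hc_map_ring\<close>.\<close>

lemma hc_sum_const_on:
  assumes U: "open_bisection G U"
  shows "hc_sum G (const_on c U) = const_on c (hc_lift G U)"
proof
  fix A
  show "hc_sum G (const_on c U) A = const_on c (hc_lift G U) A"
  proof (cases "A \<in> hc_lift G U")
    case True
    then obtain a where a: "A \<in> arr (hausdorff_cover G)" "a \<in> A" "a \<in> U"
      by (auto simp: hc_lift_def)
    have "hc_sum G (const_on c U) A = const_on c U a"
    proof (rule hc_sum_point[OF a(1,2)])
      fix x assume "x \<in> A" "x \<noteq> a"
      then have "x \<notin> U" using at_most_one_in_bisection[OF a(1) _ a(2) U _ a(3)] by blast
      then show "const_on c U x = 0" by (simp add: const_on_def)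
    qed
    then show ?thesis using True a(3) by (simp add: const_on_def)
  next
    case False
    have "supp_sum (const_on c U) A = 0" if "A \<in> arr (hausdorff_cover G)"
    proof -
      have "{a \<in> A. const_on c U a \<noteq> 0} = {}"
        using False that by (auto simp: hc_lift_def const_on_def)
      then show ?thesis by (simp add: supp_sum_def support_on_def)
    qed
    then show ?thesis using False by (simp add: hc_sum_def const_on_def)
  qed
qed

lemma compact_open_bisection_hc_sum:
  assumes U: "compact_open_bisection G U"
  shows "hc_finite G (const_on c U)"
    and "continuous_map (hcover_top G) (discrete_topology UNIV) (hc_sum G (const_on c U))"
    and "x \<notin> arr G \<Longrightarrow> const_on c U x = 0"
proof -
  have U': "open_bisection G U" "compactin (gtop G) U" "openin (gtop G) U"
    using U by (auto simp: compact_open_bisection_def open_bisection_def)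
  show "hc_finite G (const_on c U)"
    by (rule hc_finite_bisection[OF U'(1)]) (simp add: const_on_def)
  show "continuous_map (hcover_top G) (discrete_topology UNIV) (hc_sum G (const_on c U))"
    unfolding hc_sum_const_on[OF U'(1)]
    by (intro continuous_map_const_on openin_hc_lift closedin_hc_lift U')
  show "const_on c U x = 0" if "x \<notin> arr G"
    using that openin_subset[OF U'(3)] by (auto simp: const_on_def arr_def)
qed

lemma steinberg_hc_sum:
  assumes "f \<in> steinberg G"
  shows "hc_finite G f" and "continuous_map (hcover_top G) (discrete_topology UNIV) (hc_sum G f)"
    and "x \<notin> arr G \<Longrightarrow> f x = 0"
proof -
  have "hc_finite G f \<and> continuous_map (hcover_top G) (discrete_topology UNIV) (hc_sum G f) \<and>
      (\<forall>x. x \<notin> arr G \<longrightarrow> f x = 0)"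
    using assms
  proof (induction rule: steinberg_induct)
    case zero
    then show ?case by (simp add: hc_finite_zero hc_sum_zero)
  next
    case (add f c U)
    have fin: "hc_finite G f" "hc_finite G (const_on c U)"
      using add.IH compact_open_bisection_hc_sum(1)[OF add.hyps(2)] by auto
    have "hc_finite G (\<lambda>x. f x + const_on c U x)"
      by (rule hc_finite_combine[OF fin]) simp
    moreover have "continuous_map (hcover_top G) (discrete_topology UNIV)
        (hc_sum G (\<lambda>x. f x + const_on c U x))"
      unfolding hc_sum_add[OF fin]
      using add.IH compact_open_bisection_hc_sum(2)[OF add.hyps(2)]
      by (intro continuous_map_discrete_combine[where p = "(+)"]) auto
    ultimately show ?case
      using add.IH compact_open_bisection_hc_sum(3)[OF add.hyps(2)] by auto
  qed
  then show "hc_finite G f" "continuous_map (hcover_top G) (discrete_topology UNIV) (hc_sum G f)"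
    "x \<notin> arr G \<Longrightarrow> f x = 0" by auto
qed

text \<open>The restriction of \<open>hc_sum\<close> satisfies the defining conditions, and
  induction over sums of generators shows that it is the only solution, so the definite description
  evaluates to it.\<close>

lemma hc_map_ring_eq_hc_sum:
  assumes "f \<in> steinberg G"
  shows "hc_map_ring G f = hc_sum G f"
proof -
  let ?P = "\<lambda>\<phi>. \<phi> \<in> extensional (steinberg G) \<and>
             (\<forall>f \<in> steinberg G. \<forall>h \<in> steinberg G. \<phi> (\<lambda>x. f x + h x) = (\<lambda>A. \<phi> f A + \<phi> h A)) \<and>
             (\<forall>c U. compact_open_bisection G U \<longrightarrow> \<phi> (const_on c U) = const_on c (hc_lift G U))"
  let ?\<phi> = "restrict (hc_sum G) (steinberg G) :: ('a \<Rightarrow> 'b) \<Rightarrow> 'a set \<Rightarrow> 'b"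
  have "hc_map_ring G = ?\<phi>"
    unfolding hc_map_ring_def
  proof (rule the_equality)
    show "?P ?\<phi>"
    proof (intro conjI ballI allI impI)
      fix f h :: "'a \<Rightarrow> 'b" assume "f \<in> steinberg G" "h \<in> steinberg G"
      then show "?\<phi> (\<lambda>x. f x + h x) = (\<lambda>A. ?\<phi> f A + ?\<phi> h A)"
        by (simp add: steinberg_add hc_sum_add steinberg_hc_sum(1))
    next
      fix c :: 'b and U assume "compact_open_bisection G U"
      then show "?\<phi> (const_on c U) = const_on c (hc_lift G U)"
        by (simp add: const_on_in_steinberg hc_sum_const_on compact_open_bisection_def)
    qed simp
  next
    fix \<phi> :: "('a \<Rightarrow> 'b) \<Rightarrow> 'a set \<Rightarrow> 'b" assume \<phi>: "?P \<phi>"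
    show "\<phi> = ?\<phi>"
    proof (rule extensionalityI)
      fix f :: "'a \<Rightarrow> 'b" assume "f \<in> steinberg G"
      then have "\<phi> f = hc_sum G f"
      proof (induction rule: steinberg_induct)
        case zero
        \<comment> \<open>The zero function is itself a generator, which fixes the value of
          \<open>\<phi>\<close> there.\<close>
        have "\<phi> (const_on 0 {}) = const_on 0 (hc_lift G {})"
          using \<phi> compact_open_bisection_empty by blast
        then show ?case by (simp add: const_on_def hc_sum_zero)
      next
        case (add f c U)
        have c: "const_on c U \<in> steinberg G" by (rule const_on_in_steinberg[OF add.hyps(2)])
        then have "\<phi> (\<lambda>x. f x + const_on c U x) = (\<lambda>A. \<phi> f A + \<phi> (const_on c U) A)"
          using \<phi> add.hyps(1) by blast
        also have "\<phi> (const_on c U) = hc_sum G (const_on c U)"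
          using \<phi> add.hyps(2) by (simp add: hc_sum_const_on compact_open_bisection_def)
        also have "(\<lambda>A. \<phi> f A + hc_sum G (const_on c U) A) = hc_sum G (\<lambda>x. f x + const_on c U x)"
          using add.IH hc_sum_add[OF steinberg_hc_sum(1)[OF add.hyps(1)] steinberg_hc_sum(1)[OF c]]
          by simp
        finally show ?case .
      qed
      then show "\<phi> f = ?\<phi> f" using \<open>f \<in> steinberg G\<close> by simp
    qed (use \<phi> in auto)
  qed
  then show ?thesis using assms by simp
qed

text \<open>Compact open sets of the cover are closed because the cover is Hausdorff, so generators
  are locally constant on it; in \<open>G\<close> itself compact open sets can fail to be
  closed.\<close>

lemma steinberg_hausdorff_cover:
  assumes "F \<in> steinberg (hausdorff_cover G)"
  obtains S where "compactin (hcover_top G) S" "\<And>A. A \<notin> S \<Longrightarrow> F A = 0"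
    "continuous_map (hcover_top G) (discrete_topology UNIV) F"
proof -
  have "(\<exists>S. compactin (hcover_top G) S \<and> (\<forall>A. A \<notin> S \<longrightarrow> F A = 0)) \<and>
      continuous_map (hcover_top G) (discrete_topology UNIV) F"
    using assms
  proof (induction rule: steinberg_induct)
    case zero
    show ?case by auto
  next
    case (add F c W)
    have W: "openin (hcover_top G) W" "compactin (hcover_top G) W"
      using add.hyps(2) by (auto simp: compact_open_bisection_def open_bisection_def)
    have "continuous_map (hcover_top G) (discrete_topology UNIV) (\<lambda>x. F x + const_on c W x)"
      using add.IH compactin_imp_closedin[OF Hausdorff_hcover W(2)] W(1)
      by (intro continuous_map_discrete_combine[where p = "(+)"] continuous_map_const_on) auto
    moreover obtain S where S: "compactin (hcover_top G) S" "\<And>A. A \<notin> S \<Longrightarrow> F A = 0"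
      using add.IH by blast
    have "compactin (hcover_top G) (S \<union> W) \<and> (\<forall>A. A \<notin> S \<union> W \<longrightarrow> F A + const_on c W A = 0)"
      using compactin_Un[OF S(1) W(2)] S(2) by (simp add: const_on_def)
    ultimately show ?case by blast
  qed
  then show ?thesis using that by blast
qed

text \<open>\<open>Z\<close> may fail to be closed in \<open>G\<close>, but it is closed in the
  Hausdorff subspace \<open>U\<close>, which makes \<open>W - Z\<close> open. It is compact because
  \<open>Z\<close> is open.\<close>

lemma compact_open_bisection_diff:
  assumes U: "open_bisection G U" and W: "compact_open_bisection G W" "W \<subseteq> U"
    and Z: "openin (gtop G) Z" "compactin (gtop G) Z" "Z \<subseteq> U"
  shows "compact_open_bisection G (W - Z)"
proof -
  let ?X = "subtopology (gtop G) U"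
  have oU: "openin (gtop G) U" using U by (simp add: open_bisection_def)
  have oW: "openin (gtop G) W" and cW: "compactin (gtop G) W"
    using W(1) by (auto simp: compact_open_bisection_def open_bisection_def)
  have "closedin ?X Z"
    using Z by (intro compactin_imp_closedin[OF Hausdorff_space_open_bisection[OF U]])
      (simp add: compactin_subtopology)
  then have "openin ?X (W - Z)"
    using oW W(2) by (intro openin_diff) (simp_all add: openin_open_subtopology[OF oU])
  then have "openin (gtop G) (W - Z)" by (simp add: openin_open_subtopology[OF oU])
  moreover have "compactin (gtop G) (W - Z)"
  proof -
    have "closedin (gtop G) (topspace (gtop G) - Z)" using Z(1) by blast
    then have "compactin (gtop G) (W \<inter> (topspace (gtop G) - Z))"
      by (rule compact_Int_closedin[OF cW])
    moreover have "W \<inter> (topspace (gtop G) - Z) = W - Z" using openin_subset[OF oW] by blast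
    ultimately show ?thesis by simp
  qed
  ultimately show ?thesis
    using open_subset_bisection[OF U] W(2) unfolding compact_open_bisection_def by blast
qed

text \<open>The sets are made disjoint one at a time: a new \<open>W\<close> contributes its
  constant only on \<open>W - \<Union>\<W>\<close>, so earlier values are not disturbed. The common
  bisection \<open>U\<close> keeps these differences compact open. Inside \<open>V\<close> the
  values are unconstrained.\<close>

lemma steinberg_locally_constant:
  assumes U: "open_bisection G U" and "finite \<W>"
    and "\<And>W. W \<in> \<W> \<Longrightarrow> compact_open_bisection G W \<and> W \<subseteq> U \<and> (\<exists>c. \<forall>x\<in>W - V. f x = c)"
  shows "\<exists>h\<in>steinberg G. (\<forall>x\<in>\<Union>\<W> - V. h x = f x) \<and> (\<forall>x. x \<notin> \<Union>\<W> \<longrightarrow> h x = 0)"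
  using assms(2,3)
proof (induction \<W> rule: finite_induct)
  case empty
  show ?case by (intro bexI[of _ "\<lambda>_. 0"]) (auto simp: steinberg_zero)
next
  case (insert W \<W>)
  have "\<exists>h\<in>steinberg G. (\<forall>x\<in>\<Union>\<W> - V. h x = f x) \<and> (\<forall>x. x \<notin> \<Union>\<W> \<longrightarrow> h x = 0)"
    by (rule insert.IH) (rule insert.prems, simp)
  then obtain h where h: "h \<in> steinberg G" "\<forall>x\<in>\<Union>\<W> - V. h x = f x" "\<forall>x. x \<notin> \<Union>\<W> \<longrightarrow> h x = 0"
    by (elim bexE conjE) (rule that)
  obtain c where W: "compact_open_bisection G W" "W \<subseteq> U" and c: "\<forall>x\<in>W - V. f x = c"
    using insert.prems[of W] by auto
  let ?h = "\<lambda>x. h x + const_on c (W - \<Union>\<W>) x"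
  have "openin (gtop G) W'" "compactin (gtop G) W'" "W' \<subseteq> U" if "W' \<in> \<W>" for W'
    using insert.prems[of W'] that by (auto simp: compact_open_bisection_def open_bisection_def)
  then have "compact_open_bisection G (W - \<Union>\<W>)"
    using insert.hyps(1) by (intro compact_open_bisection_diff[OF U W] compactin_Union) blast+
  then have "?h \<in> steinberg G" by (rule steinberg_add_const_on[OF h(1)])
  moreover have "?h x = f x" if "x \<in> \<Union>(insert W \<W>) - V" for x
  proof (cases "x \<in> \<Union>\<W>")
    case True
    then have "x \<notin> W - \<Union>\<W>" "h x = f x" using h(2) that by auto
    then show ?thesis by (simp only: const_on_def if_False add_0_right)
  next
    case False
    then have "x \<in> W - V" "x \<in> W - \<Union>\<W>" "h x = 0" using h(3) that by auto
    then show ?thesis using c by (simp only: const_on_def if_True add_0_left)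
  qed
  moreover have "?h x = 0" if "x \<notin> \<Union>(insert W \<W>)" for x
  proof -
    have "x \<notin> W - \<Union>\<W>" "h x = 0" using h(3) that by auto
    then show ?thesis by (simp only: const_on_def if_False add_0_right)
  qed
  ultimately show ?case by (intro bexI[of _ ?h] conjI ballI allI impI)
qed

end

section \<open>Compact open bisections in an ample groupoid\<close>

context ample_groupoid
begin

text \<open>In the compact Hausdorff set \<open>K\<close> a compact connected component can be
  separated from a disjoint closed set by a clopen set. The component of \<open>g\<close> is a
  single point, so a clopen \<open>C\<close> contains \<open>g\<close> and avoids
  \<open>K - N\<close>.\<close>

lemma obtain_compact_open_bisection:
  assumes "openin (gtop G) W" "g \<in> W"
  obtains V where "compact_open_bisection G V" "g \<in> V" "V \<subseteq> W"
proof -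
  obtain U N K where U: "open_bisection G U" "openin (gtop G) N" "compactin (gtop G) K"
    "g \<in> N" "N \<subseteq> K" "K \<subseteq> U" "U \<subseteq> W"
    by (rule obtain_compact_neighbourhood[OF assms])
  let ?Y = "subtopology (gtop G) K"
  have topY: "topspace ?Y = K" using compactin_subset_topspace[OF U(3)] by auto
  have YU: "?Y = subtopology (subtopology (gtop G) U) K"
    using U(6) by (simp add: subtopology_subtopology inf.absorb2)
  have cY: "compact_space ?Y" by (rule compact_space_subtopology[OF U(3)])
  have HY: "Hausdorff_space ?Y"
    unfolding YU by (rule Hausdorff_space_subtopology[OF Hausdorff_space_open_bisection[OF U(1)]])
  have gK: "g \<in> K" using U by blast
  \<comment> \<open>The range map sends the component to a connected set of units, hence to one
    point, and it is injective on \<open>U\<close>.\<close>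
  have "connected_component_of_set ?Y g = {g}"
  proof -
    let ?C = "connected_component_of_set ?Y g"
    have C: "connectedin ?Y ?C" by (rule connectedin_connected_component_of)
    have "connectedin (unit_top G) (rng G ` ?C)"
      by (rule connectedin_continuous_map_image[OF continuous_map_from_subtopology[OF continuous_rng] C])
    then obtain a where a: "rng G ` ?C \<subseteq> {a}"
      using totally_disconnected_units unfolding totally_disconnected_def by blast
    have "?C \<subseteq> U" using connectedin_subset_topspace[OF C] topY U(6) by blast
    moreover have gC: "g \<in> ?C" using gK topY by (simp add: connected_component_of_refl)
    ultimately have "x = g" if "x \<in> ?C" for x
      using a that U(1) unfolding open_bisection_def inj_on_def by blast
    then show ?thesis using gC by blast
  qed
  then have "{g} \<in> connected_components_of ?Y"
    unfolding connected_components_of_def using gK topY by (intro image_eqI[of _ _ g]) auto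
  moreover have "compactin ?Y {g}" using gK topY by simp
  moreover have "closedin ?Y (K - N)"
    using U(2,5) topY by (auto simp: closedin_def double_diff openin_subtopology)
  moreover have "disjnt {g} (K - N)" using U(4) by (auto simp: disjnt_def)
  ultimately have "separated_between ?Y {g} (K - N)"
    by (intro separated_between_compact_connected_component compact_imp_locally_compact_space[OF cY] HY)
  then obtain C where C: "closedin ?Y C" "openin ?Y C" "g \<in> C" "K - N \<subseteq> K - C"
    unfolding separated_between topY by blast
  have "C \<subseteq> K" using closedin_subset[OF C(1)] topY by simp
  then have CN: "C \<subseteq> N" using C(4) by blast
  have "compactin ?Y C" by (rule closedin_compact_space[OF cY C(1)])
  then have "compactin (gtop G) C" by (simp add: compactin_subtopology)
  \<comment> \<open>\<open>C\<close> is only known to be open relative to \<open>K\<close>; lying in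
    the open set \<open>N \<subseteq> K\<close> makes it open in \<open>G\<close>.\<close>
  moreover have "openin (gtop G) C"
  proof -
    obtain T where T: "openin (gtop G) T" "C = T \<inter> K" using C(2) unfolding openin_subtopology by blast
    then have "C = T \<inter> N" using CN U(5) by blast
    then show ?thesis using openin_Int[OF T(1) U(2)] by simp
  qed
  ultimately have "compact_open_bisection G C"
    using open_subset_bisection[OF U(1)] CN U(5,6) unfolding compact_open_bisection_def by blast
  then show ?thesis using that C(3) CN U(5-7) by blast
qed

text \<open>\<open>U - V\<close> is compact and \<open>f\<close> is locally constant on it, so
  finitely many compact open subsets of \<open>U\<close> cover it, with \<open>f\<close> constant on
  the part of each outside \<open>V\<close>.\<close>

lemma steinberg_extension_off_open:
  assumes U: "compact_open_bisection G U" and V: "openin (gtop G) V"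
    and F: "continuous_map (hcover_top G) (discrete_topology UNIV) (hc_sum G f)"
    and f0: "\<And>x. x \<notin> U \<union> V \<Longrightarrow> f x = 0"
  shows "\<exists>h\<in>steinberg G. \<forall>x. x \<notin> V \<longrightarrow> h x = f x"
proof -
  have U': "open_bisection G U" "openin (gtop G) U" "compactin (gtop G) U"
    using U by (auto simp: compact_open_bisection_def open_bisection_def)
  have UG: "U \<subseteq> topspace (gtop G)" by (rule openin_subset[OF U'(2)])
  have cont: "continuous_map (subtopology (gtop G) (U - V)) (discrete_topology UNIV) f"
    using f0 by (intro continuous_map_off_open[OF U'(1) V _ F]) blast
  define P where "P = (\<lambda>W. compact_open_bisection G W \<and> W \<subseteq> U \<and> (\<exists>c. \<forall>x\<in>W - V. f x = c))"
  have "\<exists>W. P W \<and> g \<in> W" if g: "g \<in> U - V" for g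
  proof -
    have "openin (subtopology (gtop G) (U - V))
        {x \<in> topspace (subtopology (gtop G) (U - V)). f x \<in> {f g}}"
      by (rule openin_continuous_map_preimage[OF cont]) simp
    then obtain T where T: "openin (gtop G) T"
      "{x \<in> topspace (subtopology (gtop G) (U - V)). f x \<in> {f g}} = T \<inter> (U - V)"
      unfolding openin_subtopology by blast
    have gT: "g \<in> T \<inter> U" and fT: "\<And>x. x \<in> T \<inter> (U - V) \<Longrightarrow> f x = f g"
      using T(2) g UG by auto
    obtain W where W: "compact_open_bisection G W" "g \<in> W" "W \<subseteq> T \<inter> U"
      by (rule obtain_compact_open_bisection[OF openin_Int[OF T(1) U'(2)] gT])
    have "\<forall>x\<in>W - V. f x = f g" using fT W(3) by blast
    then show ?thesis using W unfolding P_def by blast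
  qed
  then have "U - V \<subseteq> \<Union>(Collect P)" by blast
  moreover have "compactin (gtop G) (U - V)"
  proof -
    have "closedin (gtop G) (topspace (gtop G) - V)" using V by blast
    then have "compactin (gtop G) (U \<inter> (topspace (gtop G) - V))"
      by (rule compact_Int_closedin[OF U'(3)])
    moreover have "U \<inter> (topspace (gtop G) - V) = U - V" using UG by blast
    ultimately show ?thesis by simp
  qed
  moreover have "openin (gtop G) W" if "W \<in> Collect P" for W
    using that by (simp add: P_def compact_open_bisection_def open_bisection_def)
  ultimately obtain \<W> where \<W>: "finite \<W>" "\<W> \<subseteq> Collect P" "U - V \<subseteq> \<Union>\<W>"
    using compactinD[of "gtop G" "U - V" "Collect P"] by metis
  have WP: "compact_open_bisection G W \<and> W \<subseteq> U \<and> (\<exists>c. \<forall>x\<in>W - V. f x = c)" if "W \<in> \<W>" for W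
    using \<W>(2) that unfolding P_def by blast
  have "\<exists>h\<in>steinberg G. (\<forall>x\<in>\<Union>\<W> - V. h x = f x) \<and> (\<forall>x. x \<notin> \<Union>\<W> \<longrightarrow> h x = 0)"
    by (rule steinberg_locally_constant[OF U'(1) \<W>(1)]) (rule WP)
  then obtain h where h: "h \<in> steinberg G" "\<forall>x\<in>\<Union>\<W> - V. h x = f x" "\<forall>x. x \<notin> \<Union>\<W> \<longrightarrow> h x = 0"
    by (elim bexE conjE) (rule that)
  have "h x = f x" if "x \<notin> V" for x
  proof (cases "x \<in> U")
    case True
    then show ?thesis using h(2) \<W>(3) that by blast
  next
    case False
    \<comment> \<open>The covering sets lie in \<open>U\<close>, so outside
      \<open>U \<union> V\<close> both \<open>h\<close> and \<open>f\<close> vanish.\<close>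
    then have "x \<notin> \<Union>\<W>" using WP by blast
    then show ?thesis using h(3) f0[of x] False that by simp
  qed
  then show ?thesis using h(1) by blast
qed

lemma decomposable_imp_steinberg:
  assumes fin: "hc_finite G f" and F: "hc_sum G f \<in> steinberg (hausdorff_cover G)"
    and f0: "\<And>x. x \<notin> arr G \<Longrightarrow> f x = 0"
  shows "f \<in> steinberg G"
proof -
  obtain S where S: "compactin (hcover_top G) S" "\<And>A. A \<notin> S \<Longrightarrow> hc_sum G f A = 0"
    and cont: "continuous_map (hcover_top G) (discrete_topology UNIV) (hc_sum G f)"
    by (rule steinberg_hausdorff_cover[OF F]) blast
  have base: "\<exists>U. compact_open_bisection G U \<and> g \<in> U" if "g \<in> arr G" for g
    using obtain_compact_open_bisection[of "topspace (gtop G)" g] that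
    by (metis arr_def openin_topspace)
  have open_cob: "openin (gtop G) U" if "compact_open_bisection G U" for U
    using that by (simp add: compact_open_bisection_def open_bisection_def)
  obtain \<U> where \<U>: "finite \<U>" "\<And>U. U \<in> \<U> \<Longrightarrow> compact_open_bisection G U" "S \<subseteq> hc_lift G (\<Union>\<U>)"
    by (rule hc_lift_cover[OF S(1) base open_cob]) blast+
  show ?thesis
  proof (rule peel_off_bisections[where L = "steinberg G" and T = "discrete_topology UNIV"])
    show "continuous_map (hcover_top G) (discrete_topology UNIV) (\<lambda>A. F A - H A)"
      if "continuous_map (hcover_top G) (discrete_topology UNIV) F"
        "continuous_map (hcover_top G) (discrete_topology UNIV) H" for F H :: "'a set \<Rightarrow> 'b"
      using that by (rule continuous_map_discrete_combine[where p = "(-)"])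
    show "\<exists>h\<in>steinberg G. \<forall>x. x \<notin> V \<longrightarrow> h x = f x"
      if "U \<in> \<U>" "openin (gtop G) V"
        "continuous_map (hcover_top G) (discrete_topology UNIV) (hc_sum G f)"
        "\<And>x. x \<notin> U \<union> V \<Longrightarrow> f x = 0" for U V and f :: "'a \<Rightarrow> 'b"
      by (rule steinberg_extension_off_open[OF \<U>(2)[OF that(1)] that(2-4)])
    show "f x = 0" if x: "x \<notin> \<Union>\<U>" for x
    proof (cases "x \<in> arr G")
      case True
      have "{x} \<notin> S" using \<U>(3) x by (auto simp: hc_lift_def)
      then have "hc_sum G f {x} = 0" by (rule S(2))
      then show ?thesis using hc_sum_singleton[OF True, of f] by metis
    qed (rule f0)
  qed (use steinberg_zero steinberg_add steinberg_hc_sum \<U>(1,2) open_cob fin cont in auto)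
qed

lemma image_hc_map_ring_iff_decomposable:
  assumes F: "F \<in> steinberg (hausdorff_cover G)"
  shows "F \<in> hc_map_ring G ` steinberg G \<longleftrightarrow> decomposable G F"
proof -
  have "hc_map_ring G ` steinberg G = (hc_sum G ` steinberg G :: ('a set \<Rightarrow> 'b) set)"
    by (rule image_cong[OF refl hc_map_ring_eq_hc_sum])
  moreover have "F \<in> hc_sum G ` steinberg G \<longleftrightarrow> decomposable G F"
  proof (rule image_hc_sum_iff_decomposable)
    obtain S where "compactin (hcover_top G) S" "\<And>A. A \<notin> S \<Longrightarrow> F A = 0"
      by (rule steinberg_hausdorff_cover[OF F]) blast
    then show "F A = 0" if "A \<notin> arr (hausdorff_cover G)" for A
      using that compactin_subset_topspace[of "hcover_top G" S] by auto
    show "f \<in> steinberg G" if "hc_finite G f" "\<And>x. x \<notin> arr G \<Longrightarrow> f x = 0" "hc_sum G f = F" for f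
      using decomposable_imp_steinberg[of f] that F by blast
  qed (use steinberg_hc_sum in auto)
  ultimately show ?thesis by simp
qed

end

theorem theorem4:
  fixes G :: "'g tgroupoid"
  assumes "etale_groupoid G"
  shows "(\<forall>F \<in> Cc (gtop (hausdorff_cover G)).
            F \<in> hc_map G ` span_Cc G \<longleftrightarrow> decomposable G F) \<and>
         (ample_groupoid G \<longrightarrow>
            (\<forall>F \<in> (steinberg (hausdorff_cover G) :: ('g set \<Rightarrow> 'r::ring) set).
               F \<in> hc_map_ring G ` steinberg G \<longleftrightarrow> decomposable G F))"
  using etale_groupoid.image_hc_map_iff_decomposable[OF assms]
    ample_groupoid.image_hc_map_ring_iff_decomposable[of G] by auto

end
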